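(* The usual anyon Fock space $\mathcal F^Q(\mathcal H)$ is a subspace of the extended anyon Fock space $\mathbf F^Q(\mathcal H,\nu)$, where each $f^{(n)}\in\mathcal H^{\circledast n}$ is identified with the function in $\mathbf F^Q_n(\mathcal H,\nu)$ which is equal to $f^{(n)}$ on $X^{(n)}$ and to $0$ otherwise. Furthermore, $\mathbf F^Q(\mathcal H,\nu)=\mathcal F^Q(\mathcal H)$ if and only if the measure $\nu$ is concentrated at one point.
   Context: $X=\mathbb R^d$, $m(dx)=dx$ Lebesgue measure, $\mathcal H=L^2(X,m)$ (complex). Fix $q\in\mathbb C$, $|q|=1$. $X^{(1)}=X$ and $X^{(n)}=\{(x_1,\dots,x_n)\in X^n: x_i\ne x_j\ \forall i<j\}$. $X$ has the strict lexicographic order: $x<y$ iff for some $j$, $x^1=y^1,\dots,x^{j-1}=y^{j-1}$, $x^j<y^j$. For $x\neq y$: $Q(x,y)=q$ if $x<y$, $Q(x,y)=\bar q$ if $y<x$. $\mathfrak S_n$ is the symmetric group. Anyon Fock space. $\mathcal H^{\circledast n}$ is the closed subspace of $\mathcal H^{\otimes n}=L^2(X^{(n)},m^{\otimes n})$ of functions satisfying, for $j=1,\dots,n-1$, $f^{(n)}(x_1,\dots,x_n)=Q(x_j,x_{j+1})f^{(n)}(x_1,\dots,x_{j-1},x_{j+1},x_j,x_{j+2},\dots,x_n)$; $\mathcal H^{\circledast0}=\mathbb C$. $\mathcal F^Q(\mathcal H)=\bigoplus_{n\ge0}\mathcal H^{\circledast n}n!$, i.e. $\|F\|^2=\sum_n\|f^{(n)}\|^2_{\mathcal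 H^{\otimes n}}n!$. The measure $\nu$. $\nu$ is a probability measure on $\mathbb R$ with finite moments such that the polynomials are dense in $L^2(\mathbb R,\nu)$. $(p_k)_{k\ge0}$ are its monic orthogonal polynomials (with $p_k:=0$ for $k\ge N$ if $\mathrm{supp}\,\nu$ has $N$ points), and $c_k:=\int p_{k-1}^2\,d\nu$, $k\ge1$. The measures $m_\nu^{(n)}$. $\Pi(n)$ is the set of partitions of $\{1,\dots,n\}$; the blocks of $\theta=\{\theta_1,\dots,\theta_l\}$ are always numbered so that $\max\theta_1<\dots<\max\theta_l$. $X_\theta^{(n)}$ is the set of $(x_1,\dots,x_n)\in X^n$ such that $x_i=x_j$ iff $i,j$ lie in the same block of $\theta$; these sets partition $X^n$. $m_\nu^{(n)}$ is the measure on $X^n$ whose restriction to each $X^{(n)}_\theta$ is the push-forward of $c_{|\theta_1|}\cdots c_{|\theta_l|}\,n!\,(|\theta_1|!\cdots|\theta_l|!)^{-1}m^{\otimes l}$ on $X^{(l)}$ under $(y_1,\dots,y_l)\mapsto(x_1,\dots,x_n)$, $x_i=y_j$ for $i\in\theta_j$. Extended anyon Fock space. For $\pi\in\mathfrak S_n$ and $\theta\in\Pi(n)$, let $\beta=\{\pi\theta_1,\dots,\pi\theta_l\}$, numbered as $\beta_1,\dots,\beta_l$ with $\max\beta_1<\dots<\max\beta_l$, and let $\widehat\pi\in\mathfrak S_l$ be given by $\pi\theta_i=\beta_{\widehat\pi(i)}$. For $(x_1,\dots,x_n)\in X_\theta^{(n)}$ set $Q_\pi(x_1,\dots,x_n)=\prod_{1\le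 i<j\le l,\ \widehat\pi(i)>\widehat\pi(j)}Q(x_{\theta_i},x_{\theta_j})$, where $x_{\theta_i}$ is the common value of $x_k$, $k\in\theta_i$. A function $f^{(n)}:X^n\to\mathbb C$ is $Q$-symmetric if $f^{(n)}(x_1,\dots,x_n)=Q_\pi(x_1,\dots,x_n)f^{(n)}(x_{\pi^{-1}(1)},\dots,x_{\pi^{-1}(n)})$ for all $\pi\in\mathfrak S_n$. $\mathbf F^Q_n(\mathcal H,\nu)$ is the subspace of $L^2(X^n,m_\nu^{(n)})$ of ($m_\nu^{(n)}$-versions of) $Q$-symmetric functions, $\mathbf F^Q_0(\mathcal H,\nu)=\mathbb C$, and $\mathbf F^Q(\mathcal H,\nu)=\bigoplus_{n\ge0}\mathbf F^Q_n(\mathcal H,\nu)$. *)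

theory Defs
  imports "HOL-Probability.Probability" "HOL-Computational_Algebra.Polynomial"
    "HOL-Combinatorics.Permutations" "HOL-Library.Disjoint_Sets"
begin

section \<open>Square-integrable functions modulo almost everywhere equality\<close>

definition L2_fun :: "'a measure \<Rightarrow> ('a \<Rightarrow> complex) set" where
  "L2_fun M = {f \<in> borel_measurable M. integrable M (\<lambda>x. (cmod (f x))\<^sup>2)}"

definition ae_rel :: "'a measure \<Rightarrow> (('a \<Rightarrow> complex) \<times> ('a \<Rightarrow> complex)) set" where
  "ae_rel M = {(f, g). f \<in> L2_fun M \<and> g \<in> L2_fun M \<and> (AE x in M. f x = g x)}"

definition L2 :: "'a measure \<Rightarrow> ('a \<Rightarrow> complex) set set" where
  "L2 M = L2_fun M // ae_rel M"

definition L2_normsq :: "'a measure \<Rightarrow> ('a \<Rightarrow> complex) set \<Rightarrow> real" where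
  "L2_normsq M C = the_elem ((\<lambda>f. LINT x|M. (cmod (f x))\<^sup>2) ` C)"

definition L2_add ::
  "'a measure \<Rightarrow> ('a \<Rightarrow> complex) set \<Rightarrow> ('a \<Rightarrow> complex) set \<Rightarrow> ('a \<Rightarrow> complex) set" where
  "L2_add M C D = {h \<in> L2_fun M. \<exists>f\<in>C. \<exists>g\<in>D. AE x in M. h x = f x + g x}"

definition L2_scale ::
  "'a measure \<Rightarrow> complex \<Rightarrow> ('a \<Rightarrow> complex) set \<Rightarrow> ('a \<Rightarrow> complex) set" where
  "L2_scale M a C = {h \<in> L2_fun M. \<exists>f\<in>C. AE x in M. h x = a * f x}"


section \<open>The underlying space and the anyon Fock space\<close>

text \<open>
  \<open>X\<close> is \<^typ>\<open>real ^ 'd\<close> with a linearly ordered finite index type. A point of \<open>X\<^sup>n\<close> is a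
  function on \<open>{1..n}\<close>, extended by \<^const>\<open>undefined\<close> as usual for \<^const>\<open>PiM\<close>. For \<open>n = 0\<close> this is
  a single point of mass 1, so that the spaces of order 0 below are (copies of) the complex
  numbers.
\<close>

type_synonym 'd conf = "nat \<Rightarrow> real ^ 'd"

definition lex_less :: "real ^ 'd::{finite,linorder} \<Rightarrow> real ^ 'd::{finite,linorder} \<Rightarrow> bool" where
  "lex_less x y \<longleftrightarrow> (\<exists>j. (\<forall>i<j. x $ i = y $ i) \<and> x $ j < y $ j)"

text \<open>Only relevant for \<open>x \<noteq> y\<close>.\<close>

definition Qfun :: "complex \<Rightarrow> real ^ 'd::{finite,linorder} \<Rightarrow> real ^ 'd::{finite,linorder} \<Rightarrow> complex" where
  "Qfun q x y = (if lex_less x y then q else cnj q)"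

definition Xpow :: "nat \<Rightarrow> 'd::{finite,linorder} conf set" where
  "Xpow n = {1..n} \<rightarrow>\<^sub>E UNIV"

definition mpow :: "nat \<Rightarrow> 'd::{finite,linorder} conf measure" where
  "mpow n = PiM {1..n} (\<lambda>_. lborel)"

definition Xdist :: "nat \<Rightarrow> 'd::{finite,linorder} conf set" where
  "Xdist n = {x \<in> Xpow n. inj_on x {1..n}}"

definition mXdist :: "nat \<Rightarrow> 'd::{finite,linorder} conf measure" where
  "mXdist n = restrict_space (mpow n) (Xdist n)"

definition anyon_space ::
  "complex \<Rightarrow> nat \<Rightarrow> ('d::{finite,linorder} conf \<Rightarrow> complex) set set" where
  "anyon_space q n = {C \<in> L2 (mXdist n). \<exists>f\<in>C. \<forall>j\<in>{1..<n}.
     AE x in mXdist n. f x = Qfun q (x j) (x (Suc j)) * f (x \<circ> Transposition.transpose j (Suc j))}"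

definition fock_normsq ::
  "(nat \<Rightarrow> ('d::{finite,linorder} conf \<Rightarrow> complex) set) \<Rightarrow> real" where
  "fock_normsq F = (\<Sum>n. L2_normsq (mXdist n) (F n) * fact n)"

definition anyon_fock ::
  "complex \<Rightarrow> (nat \<Rightarrow> ('d::{finite,linorder} conf \<Rightarrow> complex) set) set" where
  "anyon_fock q = {F. (\<forall>n. F n \<in> anyon_space q n) \<and>
     summable (\<lambda>n. L2_normsq (mXdist n) (F n) * fact n)}"


section \<open>The measure on the real line and its orthogonal polynomials\<close>

definition finite_moments :: "real measure \<Rightarrow> bool" where
  "finite_moments \<nu> \<longleftrightarrow> (\<forall>k::nat. integrable \<nu> (\<lambda>x. x ^ k))"

definition polys_dense :: "real measure \<Rightarrow> bool" where
  "polys_dense \<nu> \<longleftrightarrow> (\<forall>f\<in>L2_fun \<nu>. \<forall>e>0. \<exists>p :: complex poly.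
     (LINT x|\<nu>. (cmod (f x - poly p (complex_of_real x)))\<^sup>2) < e)"

definition msupport :: "real measure \<Rightarrow> real set" where
  "msupport \<nu> = {x. \<forall>U. open U \<and> x \<in> U \<longrightarrow> emeasure \<nu> U > 0}"

definition orth_poly :: "real measure \<Rightarrow> nat \<Rightarrow> real poly" where
  "orth_poly \<nu> k =
     (if finite (msupport \<nu>) \<and> card (msupport \<nu>) \<le> k then 0
      else (THE p. degree p = k \<and> lead_coeff p = 1 \<and>
              (\<forall>r. degree r < k \<longrightarrow> (LINT x|\<nu>. poly p x * poly r x) = 0)))"

definition cc :: "real measure \<Rightarrow> nat \<Rightarrow> real" where
  "cc \<nu> k = (LINT x|\<nu>. (poly (orth_poly \<nu> (k - 1)) x)\<^sup>2)"


section \<open>Set partitions and the extended anyon Fock space\<close>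

definition Parts :: "nat \<Rightarrow> nat set set set" where
  "Parts n = {\<theta>. partition_on {1..n} \<theta>}"

text \<open>Position of a block, counted from 1, when the blocks are ordered by their maxima.\<close>

definition block_index :: "nat set set \<Rightarrow> nat set \<Rightarrow> nat" where
  "block_index \<theta> B = card {A \<in> \<theta>. Max A \<le> Max B}"

definition block :: "nat set set \<Rightarrow> nat \<Rightarrow> nat set" where
  "block \<theta> i = (THE B. B \<in> \<theta> \<and> block_index \<theta> B = i)"

definition Xpart :: "nat \<Rightarrow> nat set set \<Rightarrow> 'd::{finite,linorder} conf set" where
  "Xpart n \<theta> = {x \<in> Xpow n. \<forall>i\<in>{1..n}. \<forall>j\<in>{1..n}. x i = x j \<longleftrightarrow> (\<exists>B\<in>\<theta>. i \<in> B \<and> j \<in> B)}"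

definition diag_map ::
  "nat \<Rightarrow> nat set set \<Rightarrow> 'd::{finite,linorder} conf \<Rightarrow> 'd::{finite,linorder} conf" where
  "diag_map n \<theta> y = (\<lambda>i\<in>{1..n}. y (THE j. j \<in> {1..card \<theta>} \<and> i \<in> block \<theta> j))"

definition part_coeff :: "real measure \<Rightarrow> nat \<Rightarrow> nat set set \<Rightarrow> real" where
  "part_coeff \<nu> n \<theta> =
     (\<Prod>B\<in>\<theta>. cc \<nu> (card B)) * fact n / (\<Prod>B\<in>\<theta>. fact (card B))"

definition mnu :: "real measure \<Rightarrow> nat \<Rightarrow> 'd::{finite,linorder} conf measure" where
  "mnu \<nu> n = measure_of (space (mpow n)) (sets (mpow n))
     (\<lambda>A. \<Sum>\<theta>\<in>Parts n. ennreal (part_coeff \<nu> n \<theta>) *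
        emeasure (distr (mXdist (card \<theta>)) (mpow n) (diag_map n \<theta>)) (A \<inter> Xpart n \<theta>))"

definition hat_perm :: "(nat \<Rightarrow> nat) \<Rightarrow> nat set set \<Rightarrow> nat \<Rightarrow> nat" where
  "hat_perm \<pi> \<theta> i = block_index ((`) \<pi> ` \<theta>) (\<pi> ` block \<theta> i)"

text \<open>The factor of \<open>\<pi>\<close> at a point \<open>x\<close> of \<^term>\<open>Xpart n \<theta>\<close>; there \<open>x\<close> is constant on each block.\<close>

definition Qperm ::
  "complex \<Rightarrow> (nat \<Rightarrow> nat) \<Rightarrow> nat set set \<Rightarrow> 'd::{finite,linorder} conf \<Rightarrow> complex" where
  "Qperm q \<pi> \<theta> x =
     (\<Prod>(i, j)\<in>{(i, j). 1 \<le> i \<and> i < j \<and> j \<le> card \<theta> \<and> hat_perm \<pi> \<theta> i > hat_perm \<pi> \<theta> j}.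
        Qfun q (the_elem (x ` block \<theta> i)) (the_elem (x ` block \<theta> j)))"

definition Q_symmetric ::
  "complex \<Rightarrow> nat \<Rightarrow> ('d::{finite,linorder} conf \<Rightarrow> complex) \<Rightarrow> bool" where
  "Q_symmetric q n f \<longleftrightarrow> (\<forall>\<pi>. \<pi> permutes {1..n} \<longrightarrow>
     (\<forall>\<theta>\<in>Parts n. \<forall>x\<in>Xpart n \<theta>. f x = Qperm q \<pi> \<theta> x * f (x \<circ> inv \<pi>)))"

definition ext_space ::
  "complex \<Rightarrow> real measure \<Rightarrow> nat \<Rightarrow> ('d::{finite,linorder} conf \<Rightarrow> complex) set set" where
  "ext_space q \<nu> n = {C \<in> L2 (mnu \<nu> n). \<exists>f\<in>C. Q_symmetric q n f}"

definition ext_normsq ::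
  "real measure \<Rightarrow> (nat \<Rightarrow> ('d::{finite,linorder} conf \<Rightarrow> complex) set) \<Rightarrow> real" where
  "ext_normsq \<nu> F = (\<Sum>n. L2_normsq (mnu \<nu> n) (F n))"

definition ext_fock ::
  "complex \<Rightarrow> real measure \<Rightarrow> (nat \<Rightarrow> ('d::{finite,linorder} conf \<Rightarrow> complex) set) set" where
  "ext_fock q \<nu> = {F. (\<forall>n. F n \<in> ext_space q \<nu> n) \<and>
     summable (\<lambda>n. L2_normsq (mnu \<nu> n) (F n))}"


section \<open>The identification\<close>

definition embed_n ::
  "real measure \<Rightarrow> nat \<Rightarrow> ('d::{finite,linorder} conf \<Rightarrow> complex) set
    \<Rightarrow> ('d::{finite,linorder} conf \<Rightarrow> complex) set" where
  "embed_n \<nu> n C = {g \<in> L2_fun (mnu \<nu> n).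
     \<exists>f\<in>C. AE x in mnu \<nu> n. g x = (if x \<in> Xdist n then f x else 0)}"

definition fock_embed ::
  "real measure \<Rightarrow> (nat \<Rightarrow> ('d::{finite,linorder} conf \<Rightarrow> complex) set)
    \<Rightarrow> (nat \<Rightarrow> ('d::{finite,linorder} conf \<Rightarrow> complex) set)" where
  "fock_embed \<nu> F = (\<lambda>n. embed_n \<nu> n (F n))"

definition seq_add ::
  "(nat \<Rightarrow> 'a measure) \<Rightarrow> (nat \<Rightarrow> ('a \<Rightarrow> complex) set) \<Rightarrow> (nat \<Rightarrow> ('a \<Rightarrow> complex) set)
    \<Rightarrow> nat \<Rightarrow> ('a \<Rightarrow> complex) set" where
  "seq_add M F G = (\<lambda>n. L2_add (M n) (F n) (G n))"

definition seq_scale ::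
  "(nat \<Rightarrow> 'a measure) \<Rightarrow> complex \<Rightarrow> (nat \<Rightarrow> ('a \<Rightarrow> complex) set)
    \<Rightarrow> nat \<Rightarrow> ('a \<Rightarrow> complex) set" where
  "seq_scale M a F = (\<lambda>n. L2_scale (M n) a (F n))"

end

theory Submission
  imports Defs
begin

text \<open>
  The measure \<open>mnu \<nu> n\<close> lives on the strata \<open>Xpart n \<theta>\<close>, which are disjoint for different partitions
  \<open>\<theta>\<close>. The stratum of the partition into singletons is \<open>Xdist n\<close>, and since \<open>cc \<nu> 1 = 1\<close> the measure
  restricts there to \<open>n!\<close> times Lebesgue measure (\<open>restrict_mnu_Xdist\<close>). So extension by zero maps
  \<open>L2 (mXdist n)\<close> linearly and injectively into \<open>L2 (mnu \<nu> n)\<close> and multiplies squared norms by \<open>n!\<close>,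
  which is the weight in the Fock norm.

  It remains to compare the two notions of symmetry. On \<open>Xdist n\<close> the factor of a permutation is the
  product of \<open>Q\<close> over its inversions, and sorting a permutation by adjacent transpositions produces
  precisely this product (\<open>swap_sym_imp_perm\<close>). Hence the relations for adjacent transpositions, if they
  hold at every point, are equivalent to the relations for all permutations. In the anyon space they
  hold only almost everywhere, but finitely many permuted copies of a null set form an invariant null
  set, and putting the function equal to zero there gives a representative that satisfies them
  everywhere (\<open>AE_swap_sym_version\<close>). Therefore the image of the anyon Fock space lies in the
  extended one.

  The image consists of the classes that vanish off \<open>Xdist n\<close>. If \<open>\<nu>\<close> is a point mass, the orthogonal
  polynomials of positive degree vanish, so \<open>cc \<nu> k = 0\<close> for \<open>k \<ge> 2\<close>; all strata with coincidences are
  then null sets and every class of the extended space is an image (\<open>ext_space_concentrated\<close>).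
  Otherwise \<open>cc \<nu> 2\<close> is the variance of \<open>\<nu>\<close>, which is positive. The indicator function of a cube in the
  two-particle diagonal is then a \<open>Q\<close>-symmetric function that is not a null function and vanishes on
  \<open>Xdist 2\<close>, so it is not in the image (\<open>ext_space_not_onto\<close>).
\<close>

section \<open>Classes of square-integrable functions\<close>

definition cls :: "'a measure \<Rightarrow> ('a \<Rightarrow> complex) \<Rightarrow> ('a \<Rightarrow> complex) set" where
  "cls M f = {g \<in> L2_fun M. AE x in M. g x = f x}"

lemma L2_eq_cls: "L2 M = cls M ` L2_fun M"
proof -
  have "ae_rel M `` {f} = cls M f" if "f \<in> L2_fun M" for f
    unfolding ae_rel_def cls_def using that by (auto simp: eq_commute)
  then show ?thesis
    unfolding L2_def quotient_def by (auto simp: image_def)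
qed

lemma L2E:
  assumes "C \<in> L2 M"
  obtains f where "f \<in> L2_fun M" "C = cls M f"
  using assms unfolding L2_eq_cls by auto

lemma cls_self: "f \<in> L2_fun M \<Longrightarrow> f \<in> cls M f"
  by (simp add: cls_def)

lemma cls_cong: "AE x in M. f x = g x \<Longrightarrow> cls M f = cls M g"
proof -
  assume fg: "AE x in M. f x = g x"
  have "(AE x in M. h x = f x) \<longleftrightarrow> (AE x in M. h x = g x)" for h
    by (rule eventually_subst) (use fg in \<open>eventually_elim, simp\<close>)
  then show ?thesis by (simp add: cls_def)
qed

lemma cls_eq_iff:
  assumes "f \<in> L2_fun M"
  shows "cls M f = cls M g \<longleftrightarrow> (AE x in M. f x = g x)"
proof
  assume "cls M f = cls M g"
  with cls_self[OF assms] have "f \<in> cls M g" by simp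
  then show "AE x in M. f x = g x" by (simp add: cls_def)
qed (rule cls_cong)

lemma cls_eqI:
  assumes "C \<in> L2 M" "f \<in> C"
  shows "C = cls M f" "f \<in> L2_fun M"
proof -
  obtain g where g: "g \<in> L2_fun M" "C = cls M g" using L2E[OF assms(1)] .
  show "f \<in> L2_fun M" using assms(2) g by (simp add: cls_def)
  have "AE x in M. f x = g x" using assms(2) g by (simp add: cls_def)
  then show "C = cls M f" using g cls_cong by metis
qed

lemma L2_fun_measurable: "f \<in> L2_fun M \<Longrightarrow> f \<in> borel_measurable M"
  by (simp add: L2_fun_def)

lemma cmod_add_sq_le: "(cmod (a + b))\<^sup>2 \<le> 2 * (cmod a)\<^sup>2 + 2 * (cmod b)\<^sup>2"
proof -
  have "(cmod (a + b))\<^sup>2 \<le> (cmod a + cmod b)\<^sup>2"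
    by (intro power_mono norm_triangle_ineq) auto
  also have "\<dots> \<le> 2 * (cmod a)\<^sup>2 + 2 * (cmod b)\<^sup>2"
    using zero_le_power2[of "cmod a - cmod b"] by (simp add: power2_eq_square algebra_simps)
  finally show ?thesis .
qed

lemma L2_fun_add:
  assumes f: "f \<in> L2_fun M" and g: "g \<in> L2_fun M"
  shows "(\<lambda>x. f x + g x) \<in> L2_fun M"
    and "(LINT x|M. (cmod (f x + g x))\<^sup>2)
           \<le> 2 * (LINT x|M. (cmod (f x))\<^sup>2) + 2 * (LINT x|M. (cmod (g x))\<^sup>2)"
proof -
  note [measurable] = L2_fun_measurable[OF f] L2_fun_measurable[OF g]
  have bd: "integrable M (\<lambda>x. 2 * (cmod (f x))\<^sup>2 + 2 * (cmod (g x))\<^sup>2)"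
    using f g by (auto simp: L2_fun_def)
  have int: "integrable M (\<lambda>x. (cmod (f x + g x))\<^sup>2)"
    by (rule Bochner_Integration.integrable_bound[OF bd])
       (auto simp: cmod_add_sq_le intro!: AE_I2)
  then show "(\<lambda>x. f x + g x) \<in> L2_fun M" by (simp add: L2_fun_def)
  have "(LINT x|M. (cmod (f x + g x))\<^sup>2) \<le> (LINT x|M. 2 * (cmod (f x))\<^sup>2 + 2 * (cmod (g x))\<^sup>2)"
    by (rule integral_mono[OF int bd]) (rule cmod_add_sq_le)
  also have "\<dots> = 2 * (LINT x|M. (cmod (f x))\<^sup>2) + 2 * (LINT x|M. (cmod (g x))\<^sup>2)"
    using f g by (subst Bochner_Integration.integral_add) (auto simp: L2_fun_def)
  finally show "(LINT x|M. (cmod (f x + g x))\<^sup>2)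
           \<le> 2 * (LINT x|M. (cmod (f x))\<^sup>2) + 2 * (LINT x|M. (cmod (g x))\<^sup>2)" .
qed

lemma L2_fun_scale:
  assumes f: "f \<in> L2_fun M"
  shows "(\<lambda>x. a * f x) \<in> L2_fun M"
  using f by (auto simp: L2_fun_def norm_mult power_mult_distrib)

lemma zero_L2_fun: "(\<lambda>x. 0) \<in> L2_fun M"
  by (simp add: L2_fun_def)

lemma L2_normsq_cls:
  assumes f: "f \<in> L2_fun M"
  shows "L2_normsq M (cls M f) = (LINT x|M. (cmod (f x))\<^sup>2)"
proof -
  have "(LINT x|M. (cmod (g x))\<^sup>2) = (LINT x|M. (cmod (f x))\<^sup>2)" if "g \<in> cls M f" for g
  proof (rule integral_cong_AE)
    have g: "g \<in> L2_fun M" "AE x in M. g x = f x" using that by (auto simp: cls_def)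
    note [measurable] = L2_fun_measurable[OF f] L2_fun_measurable[OF g(1)]
    show "(\<lambda>x. (cmod (g x))\<^sup>2) \<in> borel_measurable M" "(\<lambda>x. (cmod (f x))\<^sup>2) \<in> borel_measurable M"
      by simp_all
    show "AE x in M. (cmod (g x))\<^sup>2 = (cmod (f x))\<^sup>2" using g(2) by eventually_elim simp
  qed
  then have "(\<lambda>f. LINT x|M. (cmod (f x))\<^sup>2) ` cls M f = (\<lambda>f. LINT x|M. (cmod (f x))\<^sup>2) ` {f}"
  proof (intro equalityI image_subsetI)
    fix g assume "g \<in> {f}"
    then show "(LINT x|M. (cmod (g x))\<^sup>2) \<in> (\<lambda>f. LINT x|M. (cmod (f x))\<^sup>2) ` cls M f"
      using cls_self[OF f] by blast
  qed (simp only: image_insert image_empty singleton_iff)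
  then show ?thesis by (simp add: L2_normsq_def)
qed

lemma L2_normsq_nonneg: "C \<in> L2 M \<Longrightarrow> 0 \<le> L2_normsq M C"
  by (auto elim!: L2E simp: L2_normsq_cls)

lemma L2_add_cls:
  assumes f: "f \<in> L2_fun M" and g: "g \<in> L2_fun M"
  shows "L2_add M (cls M f) (cls M g) = cls M (\<lambda>x. f x + g x)"
proof -
  have "(\<exists>f'\<in>cls M f. \<exists>g'\<in>cls M g. AE x in M. h x = f' x + g' x) \<longleftrightarrow> (AE x in M. h x = f x + g x)" for h
  proof
    assume "\<exists>f'\<in>cls M f. \<exists>g'\<in>cls M g. AE x in M. h x = f' x + g' x"
    then obtain f' g' where a: "AE x in M. f' x = f x" "AE x in M. g' x = g x"
        "AE x in M. h x = f' x + g' x"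
      by (auto simp: cls_def)
    from a show "AE x in M. h x = f x + g x" by eventually_elim simp
  qed (use cls_self f g in blast)
  then show ?thesis unfolding L2_add_def by (simp add: cls_def)
qed

lemma L2_scale_cls:
  assumes f: "f \<in> L2_fun M"
  shows "L2_scale M a (cls M f) = cls M (\<lambda>x. a * f x)"
proof -
  have "(\<exists>f'\<in>cls M f. AE x in M. h x = a * f' x) \<longleftrightarrow> (AE x in M. h x = a * f x)" for h
  proof
    assume "\<exists>f'\<in>cls M f. AE x in M. h x = a * f' x"
    then obtain f' where a: "AE x in M. f' x = f x" "AE x in M. h x = a * f' x"
      by (auto simp: cls_def)
    from a show "AE x in M. h x = a * f x" by eventually_elim simp
  qed (use cls_self f in blast)
  then show ?thesis unfolding L2_scale_def by (simp add: cls_def)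
qed


section \<open>Strata of configurations and the action of permutations\<close>

lemma space_mpow: "space (mpow n) = Xpow n"
  by (simp add: mpow_def Xpow_def space_PiM)

lemma measurable_coord: "i \<in> {1..n} \<Longrightarrow> (\<lambda>x. x i) \<in> borel_measurable (mpow n)"
proof -
  assume "i \<in> {1..n}"
  then have "(\<lambda>x. x i) \<in> measurable (mpow n) lborel"
    unfolding mpow_def by (rule measurable_component_singleton)
  then show ?thesis by simp
qed

lemma measurable_coord_eq:
  assumes "i \<in> {1..n}" "j \<in> {1..n}"
  shows "{x \<in> space (mpow n). x i = (x j :: real^'d::{finite,linorder})} \<in> sets (mpow n)"
  by (rule measurable_equality_set) (use assms measurable_coord in auto)

lemma Xpart_sets: "(Xpart n \<theta> :: 'd::{finite,linorder} conf set) \<in> sets (mpow n)"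
proof -
  have "(Xpart n \<theta> :: 'd conf set) = {x \<in> space (mpow n). \<forall>i\<in>{1..n}. \<forall>j\<in>{1..n}.
      x i = x j \<longleftrightarrow> (\<exists>B\<in>\<theta>. i \<in> B \<and> j \<in> B)}"
    unfolding Xpart_def space_mpow ..
  also have "\<dots> \<in> sets (mpow n)"
  proof (intro sets.sets_Collect_finite_All)
    fix i j assume ij: "i \<in> {1..n}" "j \<in> {1..n}"
    show "{x \<in> space (mpow n). (x i = (x j :: real^'d::{finite,linorder})) = (\<exists>B\<in>\<theta>. i \<in> B \<and> j \<in> B)} \<in> sets (mpow n)"
    proof (cases "\<exists>B\<in>\<theta>. i \<in> B \<and> j \<in> B")
      case True
      then show ?thesis using measurable_coord_eq[OF ij] by simp
    next
      case False
      show ?thesis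
        using sets.sets_Collect_neg[OF measurable_coord_eq[OF ij, where ?'d='d]]
        unfolding eq_False[THEN iffD2, OF False] by simp
    qed
  qed auto
  finally show ?thesis .
qed

definition sing_part :: "nat \<Rightarrow> nat set set" where
  "sing_part n = (\<lambda>i. {i}) ` {1..n}"

lemma sing_part_in_Parts: "sing_part n \<in> Parts n"
  unfolding Parts_def sing_part_def partition_on_def by (auto simp: disjoint_def)

lemma card_sing_part: "card (sing_part n) = n"
  unfolding sing_part_def by (subst card_image) (auto simp: inj_on_def)

lemma Xpart_sing_part: "Xpart n (sing_part n) = Xdist n"
  unfolding Xpart_def sing_part_def Xdist_def inj_on_def by auto

lemma Xdist_sets: "Xdist n \<in> sets (mpow n)"
  using Xpart_sets[of n "sing_part n"] by (simp add: Xpart_sing_part)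

lemma Xdist_subset: "Xdist n \<subseteq> Xpow n"
  by (auto simp: Xdist_def)

lemma space_mXdist: "space (mXdist n) = Xdist n"
  unfolding mXdist_def space_restrict_space space_mpow using Xdist_subset by auto

text \<open>
  The blocks of the partition are the level sets of the configuration. Consequently the strata
  belonging to different partitions are disjoint.
\<close>

lemma Xpart_determines_partition:
  assumes \<theta>: "\<theta> \<in> Parts n" and x: "x \<in> Xpart n \<theta>"
  shows "\<theta> = (\<lambda>i. {j \<in> {1..n}. x j = x i}) ` {1..n}"
proof -
  have p: "partition_on {1..n} \<theta>" using \<theta> by (simp add: Parts_def)
  have blk: "B = {j \<in> {1..n}. x j = x i}" if B: "B \<in> \<theta>" "i \<in> B" for B i
  proof -
    have sub: "B \<subseteq> {1..n}" using partition_onD1[OF p] B(1) by blast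
    have "j \<in> B" if "j \<in> {1..n}" "x j = x i" for j
    proof -
      from that sub B(2) x obtain A where "A \<in> \<theta>" "j \<in> A" "i \<in> A" unfolding Xpart_def by blast
      then show ?thesis using partition_onD2[OF p] B unfolding disjoint_def by blast
    qed
    moreover have "x j = x i" if "j \<in> B" for j
      using that B sub x unfolding Xpart_def by blast
    ultimately show ?thesis using sub by blast
  qed
  show ?thesis
  proof (intro equalityI subsetI)
    fix B assume B: "B \<in> \<theta>"
    then obtain i where i: "i \<in> B" using p by (metis partition_onD3 equals0I)
    then have "i \<in> {1..n}" using partition_onD1[OF p] B by blast
    then show "B \<in> (\<lambda>i. {j \<in> {1..n}. x j = x i}) ` {1..n}" using blk[OF B i] by (rule image_eqI[rotated])
  next
    fix B assume "B \<in> (\<lambda>i. {j \<in> {1..n}. x j = x i}) ` {1..n}"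
    then obtain i where i: "B = {j \<in> {1..n}. x j = x i}" "i \<in> {1..n}" by blast
    then obtain A where A: "A \<in> \<theta>" "i \<in> A" using partition_onD1[OF p] by blast
    with blk[OF A] i show "B \<in> \<theta>" by simp
  qed
qed

lemma Xpart_inject:
  assumes "\<theta> \<in> Parts n" "x \<in> Xpart n \<theta>" "\<theta>' \<in> Parts n" "x \<in> Xpart n \<theta>'"
  shows "\<theta> = \<theta>'"
  using Xpart_determines_partition[OF assms(1,2)] Xpart_determines_partition[OF assms(3,4)]
  by (rule trans[OF _ sym])

lemma Xpow_perm: "\<sigma> permutes {1..n} \<Longrightarrow> x \<in> Xpow n \<Longrightarrow> x \<circ> \<sigma> \<in> Xpow n"
  unfolding Xpow_def by (auto simp: PiE_def extensional_def dest: permutes_not_in)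

lemma Xdist_perm: 
  assumes "\<sigma> permutes {1..n}" "x \<in> Xdist n" shows "x \<circ> \<sigma> \<in> Xdist n"
  using assms unfolding Xdist_def
  by (auto simp: Xpow_perm permutes_image permutes_inj_on intro!: comp_inj_on)

lemma Xdist_perm_iff:
  assumes "\<sigma> permutes {1..n}" shows "x \<circ> \<sigma> \<in> Xdist n \<longleftrightarrow> x \<in> Xdist n"
proof
  assume "x \<circ> \<sigma> \<in> Xdist n"
  from Xdist_perm[OF permutes_inv[OF assms] this] show "x \<in> Xdist n"
    by (simp add: comp_assoc permutes_inv_o[OF assms])
qed (rule Xdist_perm[OF assms])

lemma measurable_perm:
  assumes \<sigma>: "\<sigma> permutes {1..n}"
  shows "(\<lambda>x. x \<circ> \<sigma>) \<in> measurable (mpow n) (mpow n :: 'd::{finite,linorder} conf measure)"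
proof -
  have "(\<lambda>x. \<lambda>i\<in>{1..n}. x (\<sigma> i)) \<in> measurable (mpow n) (mpow n :: 'd conf measure)"
    unfolding mpow_def
    by (intro measurable_restrict measurable_component_singleton)
       (use permutes_in_image[OF \<sigma>] in auto)
  moreover have "(\<lambda>i\<in>{1..n}. x (\<sigma> i)) = x \<circ> \<sigma>" if "x \<in> space (mpow n)" for x :: "'d conf"
    using that \<sigma> by (auto simp: space_mpow Xpow_def fun_eq_iff PiE_def extensional_def permutes_not_in)
  ultimately show ?thesis by (subst (asm) measurable_cong) auto
qed

text \<open>
  Invariance under relabelling of the particles lets a null set be replaced by the union of its
  images under all permutations, which is again a null set.
\<close>

lemma distr_perm:
  assumes \<sigma>: "\<sigma> permutes {1..n}"
  shows "distr (mpow n) (mpow n) (\<lambda>x. x \<circ> \<sigma>) = (mpow n :: 'd::{finite,linorder} conf measure)"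
proof -
  interpret product_sigma_finite "\<lambda>_::nat. lborel :: (real^'d::{finite,linorder}) measure" ..
  let ?P = "distr (mpow n) (mpow n) (\<lambda>x. x \<circ> \<sigma>) :: 'd conf measure"
  have "?P = PiM {1..n} (\<lambda>_. lborel)"
  proof (rule PiM_eqI)
    fix A :: "nat \<Rightarrow> (real^'d::{finite,linorder}) set" assume A: "\<And>i. i \<in> {1..n} \<Longrightarrow> A i \<in> sets lborel"
    let ?B = "\<lambda>i. A (inv \<sigma> i)"
    have inv: "inv \<sigma> i \<in> {1..n} \<longleftrightarrow> i \<in> {1..n}" for i
      using permutes_in_image[OF permutes_inv[OF \<sigma>]] .
    have "(\<lambda>x. x \<circ> \<sigma>) -` Pi\<^sub>E {1..n} A \<inter> space (mpow n) = Pi\<^sub>E {1..n} ?B"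
    proof (intro equalityI subsetI)
      fix x assume x: "x \<in> (\<lambda>x. x \<circ> \<sigma>) -` Pi\<^sub>E {1..n} A \<inter> space (mpow n)"
      have "x i \<in> A (inv \<sigma> i)" if "i \<in> {1..n}" for i
      proof -
        have "(x \<circ> \<sigma>) (inv \<sigma> i) \<in> A (inv \<sigma> i)" using x inv[of i] that by (auto simp: PiE_def)
        then show ?thesis by (simp add: permutes_inverses[OF \<sigma>])
      qed
      then show "x \<in> Pi\<^sub>E {1..n} ?B" using x by (auto simp: space_mpow Xpow_def PiE_def)
    next
      fix x assume x: "x \<in> Pi\<^sub>E {1..n} ?B"
      then have sp: "x \<in> Xpow n" by (auto simp: Xpow_def)
      have "x (\<sigma> i) \<in> A i" if "i \<in> {1..n}" for i
      proof -
        have "x (\<sigma> i) \<in> A (inv \<sigma> (\<sigma> i))"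
          using x permutes_in_image[OF \<sigma>, of i] that by (auto simp: PiE_def)
        then show ?thesis by (simp add: permutes_inverses[OF \<sigma>])
      qed
      then have "x \<circ> \<sigma> \<in> Pi\<^sub>E {1..n} A"
        using Xpow_perm[OF \<sigma> sp] by (auto simp: Xpow_def PiE_def)
      then show "x \<in> (\<lambda>x. x \<circ> \<sigma>) -` Pi\<^sub>E {1..n} A \<inter> space (mpow n)"
        using sp by (simp add: space_mpow)
    qed
    then have "emeasure ?P (Pi\<^sub>E {1..n} A) = emeasure (mpow n) (Pi\<^sub>E {1..n} ?B)"
      by (subst emeasure_distr[OF measurable_perm[OF \<sigma>]])
         (use A in \<open>auto simp: mpow_def intro!: sets_PiM_I_finite\<close>)
    also have "\<dots> = (\<Prod>i\<in>{1..n}. emeasure lborel (A (inv \<sigma> i)))"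
      unfolding mpow_def by (subst emeasure_PiM) (use A inv in auto)
    also have "\<dots> = (\<Prod>i\<in>{1..n}. emeasure lborel (A i))"
      using prod.permute[OF permutes_inv[OF \<sigma>], of "\<lambda>i. emeasure lborel (A i)"] by (simp add: comp_def)
    finally show "emeasure ?P (Pi\<^sub>E {1..n} A) = (\<Prod>i\<in>{1..n}. emeasure lborel (A i))" .
  qed (auto simp: mpow_def)
  then show ?thesis by (simp add: mpow_def)
qed

lemma AE_perm:
  assumes \<sigma>: "\<sigma> permutes {1..n}"
    and P: "AE x in (mpow n :: 'd::{finite,linorder} conf measure). P x"
  shows "AE x in mpow n. P (x \<circ> \<sigma>)"
  by (rule AE_distrD[OF measurable_perm[OF \<sigma>]]) (subst distr_perm[OF \<sigma>], rule P)


section \<open>The measure on configurations with coincidences\<close>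

lemma sets_mnu: "sets (mnu \<nu> n) = sets (mpow n)"
  unfolding mnu_def by (simp add: sets.sigma_sets_eq sets.space_closed)

lemma space_mnu: "space (mnu \<nu> n) = Xpow n"
  using sets_eq_imp_space_eq[OF sets_mnu] by (simp add: space_mpow)

lemma finite_Parts: "finite (Parts n)"
  unfolding Parts_def by (rule finite_subset[of _ "Pow (Pow {1..n})"]) (auto dest: partition_onD1)

text \<open>
  What has to be checked is that the set function behind \<open>mnu\<close> is countably additive; it is, being
  a finite sum of multiples of measures, each cut down to one stratum.
\<close>

lemma emeasure_mnu:
  assumes "A \<in> sets (mpow n)"
  shows "emeasure (mnu \<nu> n) A = (\<Sum>\<theta>\<in>Parts n. ennreal (part_coeff \<nu> n \<theta>) *
        emeasure (distr (mXdist (card \<theta>)) (mpow n) (diag_map n \<theta>)) (A \<inter> Xpart n \<theta>))"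
proof (rule emeasure_measure_of[OF mnu_def])
  let ?\<mu> = "\<lambda>\<theta> A. ennreal (part_coeff \<nu> n \<theta>) *
        emeasure (distr (mXdist (card \<theta>)) (mpow n) (diag_map n \<theta>)) (A \<inter> Xpart n \<theta>)"
  have "(\<Sum>i. \<Sum>\<theta>\<in>Parts n. ?\<mu> \<theta> (F i)) = (\<Sum>\<theta>\<in>Parts n. ?\<mu> \<theta> (\<Union>i. F i))"
    if F: "range F \<subseteq> sets (mpow n)" "disjoint_family F" for F :: "nat \<Rightarrow> _"
  proof -
    have "(\<Sum>i. ?\<mu> \<theta> (F i)) = ?\<mu> \<theta> (\<Union>i. F i)" for \<theta>
    proof -
      have "(\<Sum>i. emeasure (distr (mXdist (card \<theta>)) (mpow n) (diag_map n \<theta>)) (F i \<inter> Xpart n \<theta>))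
          = emeasure (distr (mXdist (card \<theta>)) (mpow n) (diag_map n \<theta>)) (\<Union>i. F i \<inter> Xpart n \<theta>)"
        by (rule suminf_emeasure) (use F in \<open>auto simp: disjoint_family_on_def intro!: sets.Int Xpart_sets\<close>)
      then show ?thesis by (simp add: ennreal_suminf_cmult)
    qed
    then show ?thesis by (subst suminf_sum) auto
  qed
  then show "countably_additive (sets (mnu \<nu> n)) (\<lambda>A. \<Sum>\<theta>\<in>Parts n. ?\<mu> \<theta> A)"
    unfolding countably_additive_def sets_mnu by auto
qed (use assms in \<open>auto simp: sets_mnu positive_def sets.space_closed\<close>)

lemma block_index_sing_part: "i \<in> {1..n} \<Longrightarrow> block_index (sing_part n) {i} = i"
proof -
  assume i: "i \<in> {1..n}"
  have "{A \<in> sing_part n. Max A \<le> Max {i}} = (\<lambda>j. {j}) ` {1..i}"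
    using i by (auto simp: sing_part_def)
  then show ?thesis unfolding block_index_def by (simp add: card_image inj_on_def)
qed

text \<open>
  The numbering of blocks by their maxima turns the partition into singletons into the identical
  numbering of the points, so that the block indices, the diagonal map and the permutation
  \<open>hat_perm\<close> all become trivial on the stratum of distinct points.
\<close>

lemma block_sing_part:
  assumes i: "i \<in> {1..n}"
  shows "block (sing_part n) i = {i}"
  unfolding block_def
proof (rule the_equality)
  show "{i} \<in> sing_part n \<and> block_index (sing_part n) {i} = i"
    using i block_index_sing_part[OF i] by (simp add: sing_part_def)
  fix B assume B: "B \<in> sing_part n \<and> block_index (sing_part n) B = i"
  then obtain j where "j \<in> {1..n}" "B = {j}" by (auto simp: sing_part_def)
  with B block_index_sing_part[of j n] show "B = {i}" by simp
qed

lemma diag_map_sing_part: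
  assumes y: "y \<in> Xpow n"
  shows "diag_map n (sing_part n) y = y"
proof
  fix i
  have "(THE j. j \<in> {1..n} \<and> i \<in> block (sing_part n) j) = i" if "i \<in> {1..n}"
    by (rule the_equality) (use that block_sing_part in auto)
  then show "diag_map n (sing_part n) y i = y i"
    using y unfolding diag_map_def card_sing_part
    by (cases "i \<in> {1..n}") (auto simp: Xpow_def PiE_def extensional_def)
qed

lemma part_coeff_sing_part:
  "part_coeff \<nu> n (sing_part n) = cc \<nu> 1 ^ n * fact n"
proof -
  have "(\<Prod>B\<in>sing_part n. cc \<nu> (card B)) = cc \<nu> 1 ^ n"
    unfolding sing_part_def by (subst prod.reindex) (auto simp: inj_on_def)
  moreover have "(\<Prod>B\<in>sing_part n. fact (card B)) = (1::real)"
    unfolding sing_part_def by (subst prod.reindex) (auto simp: inj_on_def)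
  ultimately show ?thesis by (simp add: part_coeff_def)
qed

lemma distr_sing_part:
  fixes A :: "'d::{finite,linorder} conf set"
  assumes A: "A \<in> sets (mpow n)" "A \<subseteq> Xdist n"
  shows "emeasure (distr (mXdist n) (mpow n) (diag_map n (sing_part n))) A = emeasure (mXdist n) A"
proof -
  have "(\<lambda>x. x) \<in> measurable (mXdist n) (mpow n :: 'd conf measure)"
    unfolding mXdist_def by (rule measurable_restrict_space1) simp
  moreover have "diag_map n (sing_part n) x = x" if "x \<in> space (mXdist n)" for x :: "'d conf"
    using that Xdist_subset by (intro diag_map_sing_part) (auto simp: space_mXdist)
  ultimately have m: "diag_map n (sing_part n) \<in> measurable (mXdist n) (mpow n :: 'd conf measure)"
    using measurable_cong[of "mXdist n" "diag_map n (sing_part n)" "\<lambda>x. x" "mpow n"] by blast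
  have "diag_map n (sing_part n) -` A \<inter> space (mXdist n) = A"
  proof -
    have "diag_map n (sing_part n) x = x" if "x \<in> Xdist n" for x :: "'d conf"
      using that Xdist_subset by (intro diag_map_sing_part) auto
    then show ?thesis using A(2) unfolding space_mXdist by auto
  qed
  then show ?thesis by (simp add: emeasure_distr[OF m A(1)])
qed

text \<open>
  On a single stratum all but one of the summands defining \<open>mnu\<close> vanish.
\<close>

lemma emeasure_mnu_Xpart:
  assumes A: "A \<in> sets (mpow n)" "A \<subseteq> Xpart n \<theta>" and \<theta>: "\<theta> \<in> Parts n"
  shows "emeasure (mnu \<nu> n) A = ennreal (part_coeff \<nu> n \<theta>) *
        emeasure (distr (mXdist (card \<theta>)) (mpow n) (diag_map n \<theta>)) A"
proof -
  have "A \<inter> Xpart n \<theta>' = {}" if "\<theta>' \<in> Parts n - {\<theta>}" for \<theta>'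
    using Xpart_inject[OF \<theta>] A(2) that by blast
  then have "emeasure (mnu \<nu> n) A = (\<Sum>\<theta>'\<in>Parts n. if \<theta>' = \<theta> then ennreal (part_coeff \<nu> n \<theta>) *
        emeasure (distr (mXdist (card \<theta>)) (mpow n) (diag_map n \<theta>)) (A \<inter> Xpart n \<theta>) else 0)"
    unfolding emeasure_mnu[OF A(1)] by (intro sum.cong) auto
  also have "A \<inter> Xpart n \<theta> = A" using A(2) by auto
  finally show ?thesis by (simp add: finite_Parts \<theta>)
qed

text \<open>
  The configurations of distinct points form the stratum of the partition into singletons, whose
  coefficient is \<open>cc \<nu> 1 ^ n * n!\<close>. With \<open>cc \<nu> 1 = 1\<close> this is the weight \<open>n!\<close> that the Fock norm
  puts on the \<open>n\<close>-particle space, which makes the identification isometric. All the transfer of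
  measurability, integrals and null sets between the two spaces rests on this identity.
\<close>

lemma restrict_mnu_Xdist:
  assumes cc1: "cc \<nu> 1 = 1"
  shows "restrict_space (mnu \<nu> n) (Xdist n)
    = density (mXdist n :: 'd::{finite,linorder} conf measure) (\<lambda>_. ennreal (fact n))"
proof (rule measure_eqI)
  show s: "sets (restrict_space (mnu \<nu> n) (Xdist n)) = sets (density (mXdist n :: 'd conf measure) (\<lambda>_. ennreal (fact n)))"
    unfolding mXdist_def sets_density by (rule sets_restrict_space_cong[OF sets_mnu])
  fix A assume "A \<in> sets (restrict_space (mnu \<nu> n) (Xdist n :: 'd conf set))"
  moreover from this have AX: "A \<in> sets (mXdist n)" using s by simp
  ultimately have A: "A \<in> sets (mpow n)" "A \<subseteq> Xdist n"
    using Xdist_sets[where ?'a='d] by (auto simp: sets_restrict_space_iff sets_mnu)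
  have "emeasure (restrict_space (mnu \<nu> n) (Xdist n)) A = emeasure (mnu \<nu> n) A"
    using A Xdist_sets[of n, where ?'a='d] Xdist_subset[of n, where ?'a='d]
    by (intro emeasure_restrict_space) (auto simp: sets_mnu space_mnu Int_absorb2)
  also have "\<dots> = ennreal (fact n) * emeasure (mXdist n) A"
    using A cc1 emeasure_mnu_Xpart[of A n "sing_part n" \<nu>]
    by (simp add: Xpart_sing_part sing_part_in_Parts card_sing_part
        distr_sing_part part_coeff_sing_part)
  also have "\<dots> = emeasure (density (mXdist n) (\<lambda>_. ennreal (fact n))) A"
    using AX by (simp add: emeasure_density_const)
  finally show "emeasure (restrict_space (mnu \<nu> n) (Xdist n)) A
      = emeasure (density (mXdist n) (\<lambda>_. ennreal (fact n))) A" .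
qed


section \<open>Extension by zero\<close>

text \<open>
  The identification on the level of functions.
\<close>

definition zext :: "nat \<Rightarrow> ('d::{finite,linorder} conf \<Rightarrow> complex) \<Rightarrow> 'd conf \<Rightarrow> complex" where
  "zext n f x = (if x \<in> Xdist n then f x else 0)"

lemma zext_indicator: "zext n f = (\<lambda>x. indicat_real (Xdist n) x *\<^sub>R f x)"
  by (auto simp: zext_def fun_eq_iff)

lemma Xdist_Int_space: "(Xdist n :: 'd::{finite,linorder} conf set) \<inter> space (mnu \<nu> n) \<in> sets (mnu \<nu> n)"
  using Xdist_sets[of n, where ?'a='d] Xdist_subset[of n, where ?'a='d]
  by (simp add: sets_mnu space_mnu Int_absorb2)

lemma Xdist_Int_space_mpow: "(Xdist n :: 'd::{finite,linorder} conf set) \<inter> space (mpow n) \<in> sets (mpow n)"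
  using Xdist_sets[of n, where ?'a='d] Xdist_subset[of n, where ?'a='d]
  by (simp add: space_mpow Int_absorb2)

lemma AE_mXdist:
  "(AE x in mXdist n. P x) \<longleftrightarrow> (AE x in mpow n. x \<in> Xdist n \<longrightarrow> P (x :: 'd::{finite,linorder} conf))"
  unfolding mXdist_def by (rule AE_restrict_space_iff[OF Xdist_Int_space_mpow])

lemma AE_mnu_Xdist:
  assumes "cc \<nu> 1 = 1"
  shows "(AE x in mnu \<nu> n. x \<in> Xdist n \<longrightarrow> P x) \<longleftrightarrow>
         (AE x in mXdist n. P (x :: 'd::{finite,linorder} conf))"
proof -
  have "(AE x in mnu \<nu> n. x \<in> Xdist n \<longrightarrow> P x) \<longleftrightarrow> (AE x in restrict_space (mnu \<nu> n) (Xdist n). P x)"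
    by (rule AE_restrict_space_iff[OF Xdist_Int_space, symmetric])
  also have "\<dots> \<longleftrightarrow> (AE x in mXdist n. P x)"
    unfolding restrict_mnu_Xdist[OF assms] by (subst AE_density) auto
  finally show ?thesis .
qed

lemma measurable_restrict_mnu:
  "f \<in> borel_measurable (restrict_space (mnu \<nu> n) (Xdist n)) \<longleftrightarrow>
   f \<in> borel_measurable (mXdist n :: 'd::{finite,linorder} conf measure)"
proof -
  have "sets (restrict_space (mnu \<nu> n) (Xdist n)) = sets (mXdist n :: 'd conf measure)"
    unfolding mXdist_def by (rule sets_restrict_space_cong[OF sets_mnu])
  then have "borel_measurable (restrict_space (mnu \<nu> n) (Xdist n)) =
      (borel_measurable (mXdist n) :: ('d conf \<Rightarrow> 'a) set)"
    by (rule measurable_cong_sets) simp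
  then show ?thesis by simp
qed

lemma L2_fun_mnu_restrict:
  fixes f :: "'d::{finite,linorder} conf \<Rightarrow> complex"
  assumes cc1: "cc \<nu> 1 = 1" and f: "f \<in> L2_fun (mnu \<nu> n)"
  shows "f \<in> L2_fun (mXdist n)"
proof -
  have m: "f \<in> borel_measurable (mXdist n)"
    by (rule measurable_restrict_mnu[THEN iffD1], rule measurable_restrict_space1,
        rule L2_fun_measurable[OF f])
  have "integrable (mnu \<nu> n) (\<lambda>x. indicat_real (Xdist n) x *\<^sub>R (cmod (f x))\<^sup>2)"
    using f Xdist_sets by (intro integrable_mult_indicator) (auto simp: L2_fun_def sets_mnu)
  then have "integrable (restrict_space (mnu \<nu> n) (Xdist n)) (\<lambda>x. (cmod (f x))\<^sup>2)"
    by (subst integrable_restrict_space[OF Xdist_Int_space])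
  then have "integrable (mXdist n) (\<lambda>x. fact n *\<^sub>R (cmod (f x))\<^sup>2)"
    unfolding restrict_mnu_Xdist[OF cc1] using m by (subst (asm) integrable_density) auto
  then show ?thesis using m by (simp add: L2_fun_def)
qed

lemma zext_L2_fun:
  fixes f :: "'d::{finite,linorder} conf \<Rightarrow> complex"
  assumes cc1: "cc \<nu> 1 = 1" and f: "f \<in> L2_fun (mXdist n)"
  shows "zext n f \<in> L2_fun (mnu \<nu> n)"
    and "(LINT x|mnu \<nu> n. (cmod (zext n f x))\<^sup>2) = (LINT x|mXdist n. (cmod (f x))\<^sup>2) * fact n"
proof -
  note [measurable] = L2_fun_measurable[OF f]
  have sq: "(cmod (zext n f x))\<^sup>2 = indicat_real (Xdist n) x *\<^sub>R (cmod (f x))\<^sup>2" for x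
    by (simp add: zext_def)
  have m: "zext n f \<in> borel_measurable (mnu \<nu> n)"
    unfolding zext_indicator
    by (rule borel_measurable_restrict_space_iff[OF Xdist_Int_space, THEN iffD1],
        rule measurable_restrict_mnu[THEN iffD2], rule L2_fun_measurable[OF f])
  have "integrable (density (mXdist n) (\<lambda>_. ennreal (fact n))) (\<lambda>x. (cmod (f x))\<^sup>2)"
    using f by (subst integrable_density) (auto simp: L2_fun_def)
  then have "integrable (restrict_space (mnu \<nu> n) (Xdist n)) (\<lambda>x. (cmod (f x))\<^sup>2)"
    unfolding restrict_mnu_Xdist[OF cc1] .
  then have "integrable (mnu \<nu> n) (\<lambda>x. indicat_real (Xdist n) x *\<^sub>R (cmod (f x))\<^sup>2)"
    by (subst (asm) integrable_restrict_space[OF Xdist_Int_space])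
  then show "zext n f \<in> L2_fun (mnu \<nu> n)" using m by (simp add: L2_fun_def sq)
  have "(LINT x|mnu \<nu> n. (cmod (zext n f x))\<^sup>2)
      = (LINT x|restrict_space (mnu \<nu> n) (Xdist n). (cmod (f x))\<^sup>2)"
    unfolding sq by (rule integral_restrict_space[OF Xdist_Int_space, symmetric])
  also have "\<dots> = (LINT x|mXdist n. fact n *\<^sub>R (cmod (f x))\<^sup>2)"
    unfolding restrict_mnu_Xdist[OF cc1] by (subst integral_density) auto
  finally show "(LINT x|mnu \<nu> n. (cmod (zext n f x))\<^sup>2) = (LINT x|mXdist n. (cmod (f x))\<^sup>2) * fact n"
    by simp
qed

lemma zext_AE_iff:
  fixes f :: "'d::{finite,linorder} conf \<Rightarrow> complex"
  assumes cc1: "cc \<nu> 1 = 1"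
  shows "(AE x in mnu \<nu> n. zext n f x = zext n g x) \<longleftrightarrow> (AE x in mXdist n. f x = g x)"
proof -
  have "(zext n f x = zext n g x) \<longleftrightarrow> (x \<in> Xdist n \<longrightarrow> f x = g x)" for x
    by (simp add: zext_def)
  then show ?thesis by (simp add: AE_mnu_Xdist[OF cc1])
qed

lemma embed_cls:
  fixes f :: "'d::{finite,linorder} conf \<Rightarrow> complex"
  assumes cc1: "cc \<nu> 1 = 1" and f: "f \<in> L2_fun (mXdist n)"
  shows "embed_n \<nu> n (cls (mXdist n) f) = cls (mnu \<nu> n) (zext n f)"
proof -
  have "(\<exists>f'\<in>cls (mXdist n) f. AE x in mnu \<nu> n. h x = zext n f' x) \<longleftrightarrow>
      (AE x in mnu \<nu> n. h x = zext n f x)" for h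
  proof
    assume "\<exists>f'\<in>cls (mXdist n) f. AE x in mnu \<nu> n. h x = zext n f' x"
    then obtain f' where f': "AE x in mXdist n. f' x = f x" "AE x in mnu \<nu> n. h x = zext n f' x"
      by (auto simp: cls_def)
    have "AE x in mnu \<nu> n. zext n f' x = zext n f x" using f'(1) zext_AE_iff[OF cc1] by blast
    with f'(2) show "AE x in mnu \<nu> n. h x = zext n f x" by eventually_elim simp
  qed (use cls_self[OF f] in blast)
  then show ?thesis unfolding embed_n_def cls_def[of "mnu \<nu> n"] zext_def[symmetric] by blast
qed


section \<open>Permutation symmetry and adjacent transpositions\<close>

text \<open>
  At a configuration of distinct points, \<open>Qperm\<close> is the product \<open>Qprod\<close> over the inversions of the
  permutation. The anyon space only asks for the special case of adjacent transpositions,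
  \<open>swap_sym\<close>.
\<close>

definition inversions :: "nat \<Rightarrow> (nat \<Rightarrow> nat) \<Rightarrow> (nat \<times> nat) set" where
  "inversions n \<pi> = {(i, j). 1 \<le> i \<and> i < j \<and> j \<le> n \<and> \<pi> i > \<pi> j}"

definition Qprod :: "complex \<Rightarrow> nat \<Rightarrow> (nat \<Rightarrow> nat) \<Rightarrow> 'd::{finite,linorder} conf \<Rightarrow> complex" where
  "Qprod q n \<pi> x = (\<Prod>(i, j)\<in>inversions n \<pi>. Qfun q (x i) (x j))"

definition swap_sym :: "complex \<Rightarrow> nat \<Rightarrow> ('d::{finite,linorder} conf \<Rightarrow> complex) \<Rightarrow> bool" where
  "swap_sym q n f \<longleftrightarrow> (\<forall>x\<in>Xdist n. \<forall>j\<in>{1..<n}.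
     f x = Qfun q (x j) (x (Suc j)) * f (x \<circ> Transposition.transpose j (Suc j)))"

lemma finite_inversions: "finite (inversions n \<pi>)"
  by (rule finite_subset[of _ "{1..n} \<times> {1..n}"]) (auto simp: inversions_def)

lemma hat_perm_sing_part:
  assumes \<pi>: "\<pi> permutes {1..n}" and i: "i \<in> {1..n}"
  shows "hat_perm \<pi> (sing_part n) i = \<pi> i"
proof -
  have "(`) \<pi> ` sing_part n = (\<lambda>i. {i}) ` \<pi> ` {1..n}"
    unfolding sing_part_def by (simp add: image_image)
  also have "\<dots> = sing_part n"
    unfolding sing_part_def by (simp only: permutes_image[OF \<pi>])
  finally show ?thesis
    using block_index_sing_part[of "\<pi> i" n] permutes_in_image[OF \<pi>, of i] i
    by (simp add: hat_perm_def block_sing_part)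
qed

lemma Qperm_sing_part:
  assumes \<pi>: "\<pi> permutes {1..n}"
  shows "Qperm q \<pi> (sing_part n) x = Qprod q n \<pi> x"
  unfolding Qperm_def Qprod_def
proof (rule prod.cong)
  show "{(i, j). 1 \<le> i \<and> i < j \<and> j \<le> card (sing_part n) \<and>
      hat_perm \<pi> (sing_part n) j < hat_perm \<pi> (sing_part n) i} = inversions n \<pi>"
    unfolding inversions_def card_sing_part using hat_perm_sing_part[OF \<pi>] by auto
  show "(case p of (i, j) \<Rightarrow> Qfun q (the_elem (x ` block (sing_part n) i)) (the_elem (x ` block (sing_part n) j)))
      = (case p of (i, j) \<Rightarrow> Qfun q (x i) (x j))" if "p \<in> inversions n \<pi>" for p
    using that by (auto simp: inversions_def block_sing_part)
qed

text \<open>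
  A permutation of \<open>{1..n}\<close> without descents is strictly increasing there, so it fixes the points
  one after the other: if all smaller points are fixed, \<open>i\<close> can be the image neither of a smaller
  nor of a larger point.
\<close>

lemma no_descent_imp_id:
  assumes \<pi>: "\<pi> permutes {1..n}" and mono: "\<And>i. i \<in> {1..<n} \<Longrightarrow> \<pi> i < \<pi> (Suc i)"
  shows "\<pi> = id"
proof -
  have lt: "i \<in> {1..n} \<Longrightarrow> k \<in> {1..n} \<Longrightarrow> i < k \<Longrightarrow> \<pi> i < \<pi> k" for i k
  proof (induction k)
    case (Suc k)
    show ?case
    proof (cases "i = k")
      case True then show ?thesis using mono[of k] Suc.prems by auto
    next
      case False
      then have "\<pi> i < \<pi> k" using Suc by auto
      also have "\<pi> k < \<pi> (Suc k)" using mono[of k] Suc.prems False by auto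
      finally show ?thesis .
    qed
  qed simp
  have "i \<in> {1..n} \<longrightarrow> \<pi> i = i" for i
  proof (induction i rule: less_induct)
    case (less i)
    show ?case
    proof
      assume i: "i \<in> {1..n}"
      define m where "m = inv \<pi> i"
      have m: "\<pi> m = i" "m \<in> {1..n}"
        using permutes_inverses[OF \<pi>] permutes_in_image[OF permutes_inv[OF \<pi>], of i] i
        by (auto simp: m_def)
      have \<pi>i: "\<pi> i \<in> {1..n}" using permutes_in_image[OF \<pi>] i by blast
      have "\<not> m < i" using less.IH[of m] m by auto
      moreover have "\<not> i < m"
      proof
        assume "i < m"
        then have "\<pi> i < i" using lt[of i m] i m by simp
        with less.IH[of "\<pi> i"] \<pi>i have "\<pi> (\<pi> i) = \<pi> i" by auto
        then have "\<pi> i = i" using permutes_inj[OF \<pi>] by (auto dest: injD)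
        with \<open>\<pi> i < i\<close> show False by simp
      qed
      ultimately show "\<pi> i = i" using m by auto
    qed
  qed
  then show ?thesis using permutes_not_in[OF \<pi>] by (metis eq_id_iff)
qed


text \<open>
  Composing with the transposition at a descent removes exactly the inversion at that descent and
  transports all the others.
\<close>

lemma inversions_descent:
  fixes \<pi> :: "nat \<Rightarrow> nat"
  assumes j: "j \<in> {1..<n}" and desc: "\<pi> (Suc j) < \<pi> j"
  defines "s \<equiv> Transposition.transpose j (Suc j)"
  shows "bij_betw (\<lambda>(a, b). (s a, s b)) (inversions n (\<pi> \<circ> s)) (inversions n \<pi> - {(j, Suc j)})"
proof (rule bij_betw_byWitness[where f' = "\<lambda>(a, b). (s a, s b)"])
  have sv: "s a = (if a = j then Suc j else if a = Suc j then j else a)" for a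
    by (simp add: s_def Transposition.transpose_def)
  have range: "1 \<le> s a \<and> s a \<le> n" if "1 \<le> a" "a \<le> n" for a
    using that j by (simp add: sv)
  have less: "s a < s b" if "a < b" "a \<noteq> j \<or> b \<noteq> Suc j" for a b
    using that by (auto simp: sv)
  have ss: "s (s a) = a" for a by (simp add: s_def)
  have sj: "s a = j \<longleftrightarrow> a = Suc j" "s a = Suc j \<longleftrightarrow> a = j" for a by (auto simp: sv)
  show "(\<lambda>(a, b). (s a, s b)) ` inversions n (\<pi> \<circ> s) \<subseteq> inversions n \<pi> - {(j, Suc j)}"
  proof (rule image_subsetI, clarify)
    fix a b assume "(a, b) \<in> inversions n (\<pi> \<circ> s)"
    then have ab: "1 \<le> a" "a < b" "b \<le> n" "\<pi> (s b) < \<pi> (s a)" by (auto simp: inversions_def)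
    have "a \<noteq> j \<or> b \<noteq> Suc j" using ab(4) desc sj by (metis less_asym)
    then show "(s a, s b) \<in> inversions n \<pi> - {(j, Suc j)}"
      using ab less[of a b] range[of a] range[of b] sj[of a] sj[of b]
      unfolding inversions_def by simp
  qed
  show "(\<lambda>(a, b). (s a, s b)) ` (inversions n \<pi> - {(j, Suc j)}) \<subseteq> inversions n (\<pi> \<circ> s)"
  proof (rule image_subsetI)
    fix p assume "p \<in> inversions n \<pi> - {(j, Suc j)}"
    then obtain a b where p: "p = (a, b)" "1 \<le> a" "a < b" "b \<le> n" "\<pi> b < \<pi> a"
      "a \<noteq> j \<or> b \<noteq> Suc j"
      by (auto simp: inversions_def)
    then show "(case p of (a, b) \<Rightarrow> (s a, s b)) \<in> inversions n (\<pi> \<circ> s)"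
      using less[of a b] range[of a] range[of b] by (simp add: inversions_def ss)
  qed
qed (simp_all add: s_def split_beta)

lemma Qprod_descent:
  assumes j: "j \<in> {1..<n}" and desc: "\<pi> (Suc j) < \<pi> j"
  defines "s \<equiv> Transposition.transpose j (Suc j)"
  shows "Qprod q n \<pi> x = Qfun q (x j) (x (Suc j)) * Qprod q n (\<pi> \<circ> s) (x \<circ> s)"
proof -
  have "(\<Prod>p\<in>inversions n (\<pi> \<circ> s).
        (\<lambda>(a, b). Qfun q (x a) (x b)) ((\<lambda>(a, b). (s a, s b)) p))
      = (\<Prod>p\<in>inversions n \<pi> - {(j, Suc j)}. (\<lambda>(a, b). Qfun q (x a) (x b)) p)"
    by (rule prod.reindex_bij_betw)
       (use inversions_descent[of j n \<pi>, OF j desc] in \<open>simp add: s_def\<close>)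
  then have "Qprod q n (\<pi> \<circ> s) (x \<circ> s)
      = (\<Prod>(a, b)\<in>inversions n \<pi> - {(j, Suc j)}. Qfun q (x a) (x b))"
    by (simp add: Qprod_def split_beta)
  moreover have "(j, Suc j) \<in> inversions n \<pi>" using j desc by (auto simp: inversions_def)
  ultimately show ?thesis
    unfolding Qprod_def[of q n \<pi>] by (simp add: prod.remove[OF finite_inversions])
qed

text \<open>
  Every permutation is sorted by adjacent transpositions at descents. Each such step removes one
  inversion and contributes the factor \<open>Q\<close> of that inversion, by \<open>Qprod_descent\<close>; hence induction on
  the number of inversions, generalised over the configuration because it is permuted along the way.
\<close>

lemma swap_sym_imp_perm:
  assumes f: "swap_sym q n f"
  shows "\<pi> permutes {1..n} \<Longrightarrow> x \<in> Xdist n \<Longrightarrow> f x = Qprod q n \<pi> x * f (x \<circ> inv \<pi>)"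
proof (induction "card (inversions n \<pi>)" arbitrary: \<pi> x rule: less_induct)
  case less
  show ?case
  proof (cases "\<exists>j\<in>{1..<n}. \<pi> (Suc j) < \<pi> j")
    case False
    have "\<pi> i < \<pi> (Suc i)" if "i \<in> {1..<n}" for i
      using False that permutes_inj[OF less.prems(1)] by (metis injD linorder_less_linear n_not_Suc_n)
    then have "\<pi> = id" using no_descent_imp_id[OF less.prems(1)] by blast
    then have "inversions n \<pi> = {}" by (auto simp: inversions_def)
    with \<open>\<pi> = id\<close> show ?thesis by (simp add: Qprod_def)
  next
    case True
    then obtain j where j: "j \<in> {1..<n}" and desc: "\<pi> (Suc j) < \<pi> j" by blast
    define s where "s = Transposition.transpose j (Suc j)"
    have s: "s permutes {1..n}" unfolding s_def by (rule permutes_swap_id) (use j in auto)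
    have \<pi>s: "\<pi> \<circ> s permutes {1..n}" by (rule permutes_compose[OF s less.prems(1)])
    have "card (inversions n (\<pi> \<circ> s)) = card (inversions n \<pi> - {(j, Suc j)})"
      using inversions_descent[of j n \<pi>, OF j desc] unfolding s_def by (rule bij_betw_same_card)
    also have "\<dots> < card (inversions n \<pi>)"
      by (rule card_Diff1_less[OF finite_inversions]) (use j desc in \<open>auto simp: inversions_def\<close>)
    finally have "f (x \<circ> s) = Qprod q n (\<pi> \<circ> s) (x \<circ> s) * f (x \<circ> s \<circ> inv (\<pi> \<circ> s))"
      using less.hyps \<pi>s Xdist_perm[OF s less.prems(2)] by blast
    moreover have "x \<circ> s \<circ> inv (\<pi> \<circ> s) = x \<circ> inv \<pi>"
    proof -
      have "inv (\<pi> \<circ> s) = inv s \<circ> inv \<pi>"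
        by (rule o_inv_distrib) (use permutes_bij s less.prems(1) in auto)
      then show ?thesis using permutes_inv_o(1)[OF s] by (metis comp_assoc comp_id)
    qed
    moreover have "f x = Qfun q (x j) (x (Suc j)) * f (x \<circ> s)"
      using f j less.prems(2) unfolding swap_sym_def s_def by blast
    ultimately show ?thesis
      using Qprod_descent[of j n \<pi> q x, OF j desc] by (simp add: s_def)
  qed
qed

lemma Q_symmetric_imp_swap_sym:
  fixes f :: "'d::{finite,linorder} conf \<Rightarrow> complex"
  assumes f: "Q_symmetric q n f"
  shows "swap_sym q n f"
  unfolding swap_sym_def
proof (intro ballI)
  fix x :: "'d conf" and j assume x: "x \<in> Xdist n" and j: "j \<in> {1..<n}"
  define s where "s = Transposition.transpose j (Suc j)"
  have s: "s permutes {1..n}" unfolding s_def by (rule permutes_swap_id) (use j in auto)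
  have sv: "s a = (if a = j then Suc j else if a = Suc j then j else a)" for a
    by (simp add: s_def Transposition.transpose_def)
  have "inversions n s = {(j, Suc j)}"
    using j by (auto simp: inversions_def sv split: if_splits)
  moreover have "f x = Qprod q n s x * f (x \<circ> inv s)"
    using f s sing_part_in_Parts[of n] x
    unfolding Q_symmetric_def Qperm_sing_part[OF s, symmetric] Xpart_sing_part[symmetric] by blast
  ultimately show "f x = Qfun q (x j) (x (Suc j)) * f (x \<circ> Transposition.transpose j (Suc j))"
    by (simp add: Qprod_def s_def)
qed

text \<open>
  Off the configurations of distinct points both sides of the symmetry condition are \<open>0\<close>, since that
  set and its complement are invariant under permutations.
\<close>

lemma swap_sym_imp_Q_symmetric:
  fixes f :: "'d::{finite,linorder} conf \<Rightarrow> complex"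
  assumes f: "swap_sym q n f" and z: "\<And>x. x \<notin> Xdist n \<Longrightarrow> f x = 0"
  shows "Q_symmetric q n f"
  unfolding Q_symmetric_def
proof (intro allI impI ballI)
  fix \<pi> \<theta> and x :: "'d conf"
  assume \<pi>: "\<pi> permutes {1..n}" and \<theta>: "\<theta> \<in> Parts n" and x: "x \<in> Xpart n \<theta>"
  show "f x = Qperm q \<pi> \<theta> x * f (x \<circ> inv \<pi>)"
  proof (cases "x \<in> Xdist n")
    case True
    then have "\<theta> = sing_part n" using Xpart_inject[OF \<theta> x sing_part_in_Parts] by (simp add: Xpart_sing_part)
    then show ?thesis using swap_sym_imp_perm[OF f \<pi> True] by (simp add: Qperm_sing_part[OF \<pi>])
  next
    case False
    then show ?thesis using z Xdist_perm_iff[OF permutes_inv[OF \<pi>], of x] by simp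
  qed
qed

text \<open>
  In the anyon space the relations hold only almost everywhere, whereas \<open>Q_symmetric\<close> is a condition
  at every point. To pass from one to the other, let \<open>N\<close> be a null set containing all points at which
  some relation fails, and set the function to \<open>0\<close> on all permuted images of \<open>N\<close>. These images form a
  null set, so the class is unchanged; and since their union is invariant under permutations, each
  relation now either is one of the original function outside \<open>N\<close> or reads \<open>0 = 0\<close>.
\<close>

lemma AE_swap_sym_version:
  fixes f :: "'d::{finite,linorder} conf \<Rightarrow> complex"
  assumes f: "f \<in> L2_fun (mXdist n)"
    and swap: "\<forall>j\<in>{1..<n}. AE x in mXdist n.
      f x = Qfun q (x j) (x (Suc j)) * f (x \<circ> Transposition.transpose j (Suc j))"
  shows "\<exists>g \<in> cls (mXdist n) f. swap_sym q n g \<and> (\<forall>x. x \<notin> Xdist n \<longrightarrow> g x = 0)"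
proof -
  let ?S = "\<lambda>x. \<forall>j\<in>{1..<n}. x \<in> Xdist n \<longrightarrow>
      f x = Qfun q (x j) (x (Suc j)) * f (x \<circ> Transposition.transpose j (Suc j))"
  have "AE x in mpow n. ?S x"
    by (rule AE_finite_allI) (use swap[unfolded AE_mXdist] in auto)
  then obtain N where N: "{x \<in> space (mpow n). \<not> ?S x} \<subseteq> N" "emeasure (mpow n) N = 0" "N \<in> sets (mpow n)"
    by (rule AE_E)
  have AEN: "AE x in mpow n. x \<notin> N"
    using N by (intro AE_not_in) (auto simp: null_sets_def)
  define G where "G = {x \<in> Xdist n. \<forall>\<sigma>\<in>{\<sigma>. \<sigma> permutes {1..n}}. x \<circ> \<sigma> \<notin> N}"
  define g where "g x = (if x \<in> G then f x else 0)" for x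
  have GX: "G \<subseteq> Xdist n" by (auto simp: G_def)
  have G: "G \<in> sets (mpow n)"
  proof -
    have "{x \<in> space (mpow n). \<forall>\<sigma>\<in>{\<sigma>. \<sigma> permutes {1..n}}. x \<circ> \<sigma> \<notin> N} \<in> sets (mpow n)"
    proof (intro sets.sets_Collect_finite_All sets.sets_Collect_neg)
      fix \<sigma> assume "\<sigma> \<in> {\<sigma>. \<sigma> permutes {1..n}}"
      then have "(\<lambda>x. x \<circ> \<sigma>) -` N \<inter> space (mpow n) \<in> sets (mpow n)"
        by (intro measurable_sets[OF measurable_perm N(3)]) simp
      also have "(\<lambda>x. x \<circ> \<sigma>) -` N \<inter> space (mpow n) = {x \<in> space (mpow n). x \<circ> \<sigma> \<in> N}" by auto
      finally show "{x \<in> space (mpow n). x \<circ> \<sigma> \<in> N} \<in> sets (mpow n)" .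
    qed (simp add: finite_permutations)
    from sets.Int[OF Xdist_sets[of n] this] show ?thesis
      unfolding G_def using Xdist_subset[of n, where ?'a='d] by (simp add: space_mpow Int_def subset_iff conj_ac cong: conj_cong)
  qed
  have "AE x in mpow n. \<forall>\<sigma>\<in>{\<sigma>. \<sigma> permutes {1..n}}. x \<circ> \<sigma> \<notin> N"
    by (rule AE_finite_allI) (use AE_perm[OF _ AEN] finite_permutations in auto)
  then have AEg: "AE x in mXdist n. g x = f x"
    unfolding AE_mXdist by eventually_elim (simp add: g_def G_def)
  have "G \<in> sets (mXdist n)"
    unfolding mXdist_def using G GX by (simp add: sets_restrict_space_iff[OF Xdist_Int_space_mpow])
  then have gm: "g \<in> borel_measurable (mXdist n)"
    unfolding g_def using L2_fun_measurable[OF f] by (intro measurable_If_set) auto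
  have "integrable (mXdist n) (\<lambda>x. (cmod (g x))\<^sup>2) \<longleftrightarrow> integrable (mXdist n) (\<lambda>x. (cmod (f x))\<^sup>2)"
  proof (rule integrable_cong_AE)
    show "AE x in mXdist n. (cmod (g x))\<^sup>2 = (cmod (f x))\<^sup>2" using AEg by eventually_elim simp
  qed (use gm L2_fun_measurable[OF f] in auto)
  then have "g \<in> cls (mXdist n) f"
    using f gm AEg by (simp add: cls_def L2_fun_def)
  moreover have "swap_sym q n g"
    unfolding swap_sym_def
  proof (intro ballI)
    fix x :: "'d conf" and j assume x: "x \<in> Xdist n" and j: "j \<in> {1..<n}"
    define s where "s = Transposition.transpose j (Suc j)"
    have s: "s permutes {1..n}" unfolding s_def by (rule permutes_swap_id) (use j in auto)
    have G_perm: "y \<circ> s \<in> G" if "y \<in> G" for y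
      using that Xdist_perm[OF s] permutes_compose[OF _ s] by (auto simp: G_def comp_assoc)
    have ss: "x \<circ> s \<circ> s = x" by (simp add: s_def comp_assoc)
    show "g x = Qfun q (x j) (x (Suc j)) * g (x \<circ> Transposition.transpose j (Suc j))"
    proof (cases "x \<in> G")
      case True
      have "x \<circ> id \<notin> N" using True permutes_id unfolding G_def by blast
      then have "?S x" using N(1) x Xdist_subset[of n] by (auto simp: space_mpow)
      then show ?thesis using x j True G_perm[OF True] by (simp add: g_def s_def)
    next
      case False
      then have "x \<circ> s \<notin> G" using G_perm[of "x \<circ> s"] by (simp only: ss) blast
      then show ?thesis using False by (simp add: g_def s_def)
    qed
  qed
  moreover have "\<forall>x. x \<notin> Xdist n \<longrightarrow> g x = 0" using GX by (auto simp: g_def)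
  ultimately show ?thesis by blast
qed

text \<open>
  Representatives for which the relations hold everywhere. They are closed under pointwise linear
  operations, which reduces the linear structure of the anyon space to that of functions.
\<close>

definition anyon_fun :: "complex \<Rightarrow> nat \<Rightarrow> ('d::{finite,linorder} conf \<Rightarrow> complex) set" where
  "anyon_fun q n = {f \<in> L2_fun (mXdist n). swap_sym q n f \<and> (\<forall>x. x \<notin> Xdist n \<longrightarrow> f x = 0)}"

lemma anyon_space_eq:
  "(anyon_space q n :: ('d::{finite,linorder} conf \<Rightarrow> complex) set set) = cls (mXdist n) ` anyon_fun q n"
proof (intro equalityI subsetI)
  fix C :: "('d conf \<Rightarrow> complex) set" assume C: "C \<in> anyon_space q n"
  then obtain f where f: "C \<in> L2 (mXdist n)" "f \<in> C" "\<forall>j\<in>{1..<n}. AE x in mXdist n.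
      f x = Qfun q (x j) (x (Suc j)) * f (x \<circ> Transposition.transpose j (Suc j))"
    unfolding anyon_space_def by blast
  note Cf = cls_eqI[OF f(1,2)]
  from AE_swap_sym_version[OF Cf(2) f(3)] obtain g
    where g: "g \<in> C" "swap_sym q n g \<and> (\<forall>x. x \<notin> Xdist n \<longrightarrow> g x = 0)" unfolding Cf(1) by blast
  with cls_eqI[OF f(1) g(1)] show "C \<in> cls (mXdist n) ` anyon_fun q n"
    unfolding anyon_fun_def by blast
next
  fix C :: "('d conf \<Rightarrow> complex) set" assume "C \<in> cls (mXdist n) ` anyon_fun q n"
  then obtain f where f: "C = cls (mXdist n) f" "f \<in> L2_fun (mXdist n)" "swap_sym q n f"
    by (auto simp: anyon_fun_def)
  have "AE x in mXdist n. f x = Qfun q (x j) (x (Suc j)) * f (x \<circ> Transposition.transpose j (Suc j))"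
    if "j \<in> {1..<n}" for j
    by (rule AE_I2) (use f(3) that in \<open>auto simp: swap_sym_def space_mXdist\<close>)
  then show "C \<in> anyon_space q n"
    unfolding anyon_space_def mem_Collect_eq L2_eq_cls using f(1,2) cls_self[OF f(2)] by blast
qed


section \<open>The one-dimensional measure\<close>

text \<open>
  The complement of the support is a union of open null sets, and by the Lindelof property
  countably many of them suffice.
\<close>

lemma emeasure_compl_msupport:
  assumes s: "sets \<nu> = sets borel"
  shows "emeasure \<nu> (- msupport \<nu>) = 0"
proof -
  define \<F> where "\<F> = {U. open U \<and> emeasure \<nu> U = 0}"
  have un: "- msupport \<nu> = \<Union>\<F>"
    by (auto simp: \<F>_def msupport_def zero_less_iff_neq_zero)
  obtain \<F>' where F': "\<F>' \<subseteq> \<F>" "countable \<F>'" "\<Union>\<F>' = \<Union>\<F>"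
    using Lindelof[of \<F>] by (auto simp: \<F>_def)
  have "(\<Union>U\<in>\<F>'. U) \<in> null_sets \<nu>"
    by (rule null_sets_UN'[OF F'(2)]) (use F'(1) s in \<open>auto simp: \<F>_def null_sets_def\<close>)
  then show ?thesis using un F'(3) by (simp add: null_setsD1)
qed

lemma (in real_distribution) msupport_nonempty: "msupport M \<noteq> {}"
proof
  assume "msupport M = {}"
  then have "emeasure M UNIV = 0" using emeasure_compl_msupport[OF events_eq_borel] by simp
  then show False using emeasure_space_1 by simp
qed

lemma (in real_distribution) cc_1: "cc M 1 = 1"
proof -
  have "orth_poly M 0 = (THE p. degree p = 0 \<and> lead_coeff p = 1)"
    using msupport_nonempty by (auto simp: orth_poly_def)
  also have "\<dots> = 1"
    by (rule the_equality) (auto elim!: degree_eq_zeroE)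
  finally show ?thesis by (simp add: cc_def prob_space[simplified])
qed

text \<open>
  The support is a single point, so \<open>orth_poly\<close> is \<open>0\<close> by convention in all positive degrees.
\<close>

lemma (in real_distribution) cc_concentrated:
  assumes a: "measure M {a} = 1" and k: "k \<ge> 2"
  shows "cc M k = 0"
proof -
  have "emeasure M (- {a}) = 0"
    using prob_compl[of "{a}"] a by (simp add: Compl_eq_Diff_UNIV emeasure_eq_measure)
  then have "x \<notin> msupport M" if "x \<noteq> a" for x
    using that by (auto simp: msupport_def intro!: exI[of _ "- {a}"])
  moreover have "a \<in> msupport M"
  proof -
    have "emeasure M U > 0" if "open U" "a \<in> U" for U
    proof -
      have "emeasure M {a} \<le> emeasure M U" using that by (intro emeasure_mono) auto
      then show ?thesis using a by (simp add: emeasure_eq_measure)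
    qed
    then show ?thesis by (auto simp: msupport_def)
  qed
  ultimately have "msupport M = {a}" by blast
  then have "orth_poly M (k - 1) = 0" using k by (simp add: orth_poly_def)
  then show ?thesis by (simp add: cc_def)
qed

text \<open>
  If no point carries the whole mass, the support has at least two points, so the first monic
  orthogonal polynomial is \<open>x - m\<close> with \<open>m\<close> the mean, and \<open>cc M 2\<close> is the variance.
\<close>

lemma (in real_distribution) cc_2_pos:
  assumes mom: "finite_moments M" and nc: "\<nexists>a. measure M {a} = 1"
  shows "cc M 2 > 0"
proof -
  have supp: "\<not> (finite (msupport M) \<and> card (msupport M) \<le> 1)"
  proof
    assume fin: "finite (msupport M) \<and> card (msupport M) \<le> 1"
    then have "card (msupport M) = 1"
      using msupport_nonempty by (metis One_nat_def card_0_eq le_antisym not_less_eq_eq le0)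
    then obtain a where a: "msupport M = {a}" by (rule card_1_singletonE)
    then have "measure M (- {a}) = 0"
      using emeasure_compl_msupport[OF events_eq_borel] by (simp add: measure_def)
    then have "measure M {a} = 1" using prob_compl[of "{a}"] by (simp add: Compl_eq_Diff_UNIV)
    with nc show False by blast
  qed
  have int1: "integrable M (\<lambda>x. x)" and int2: "integrable M (\<lambda>x. x\<^sup>2)"
    using mom[unfolded finite_moments_def, rule_format, of 1]
      mom[unfolded finite_moments_def, rule_format, of 2] by simp_all
  define m where "m = (LINT x|M. x)"
  have lin: "(LINT x|M. c + x) = c + m" for c
    using int1 prob_space by (simp add: m_def)
  have "orth_poly M 1 = (THE p. degree p = 1 \<and> lead_coeff p = 1 \<and>
              (\<forall>r. degree r < 1 \<longrightarrow> (LINT x|M. poly p x * poly r x) = 0))"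
    unfolding orth_poly_def using supp by auto
  also have "\<dots> = [:- m, 1:]"
  proof (rule the_equality)
    have "(LINT x|M. poly [:- m, 1:] x * poly r x) = 0" if "degree r < 1" for r
    proof -
      have "degree r = 0" using that by simp
      then obtain d where "r = [:d:]" by (rule degree_eq_zeroE)
      moreover have "(LINT x|M. (- m + x) * d) = (LINT x|M. - m + x) * d" by simp
      ultimately show ?thesis using lin[of "- m"] by simp
    qed
    then show "degree [:- m, 1:] = 1 \<and> lead_coeff [:- m, 1:] = 1 \<and>
       (\<forall>r. degree r < 1 \<longrightarrow> (LINT x|M. poly [:- m, 1:] x * poly r x) = 0)" by simp
  next
    fix p :: "real poly"
    assume p: "degree p = 1 \<and> lead_coeff p = 1 \<and>
        (\<forall>r. degree r < 1 \<longrightarrow> (LINT x|M. poly p x * poly r x) = 0)"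
    obtain c p' where cp: "p = pCons c p'" by (cases p)
    with p have "p' \<noteq> 0" "degree p' = 0" by (auto split: if_splits)
    with p cp have c: "p = [:c, 1:]" by (auto elim: degree_eq_zeroE)
    have "(LINT x|M. poly p x * poly 1 x) = 0" using p by (metis degree_1 zero_less_one)
    then have "c + m = 0" using lin[of c] by (simp add: c)
    then show "p = [:- m, 1:]" using c by simp
  qed
  finally have cc2: "cc M 2 = (LINT x|M. (x - m)\<^sup>2)" by (simp add: cc_def)
  have int: "integrable M (\<lambda>x. (x - m)\<^sup>2)"
    unfolding power2_diff using int1 int2 by (intro Bochner_Integration.integrable_add Bochner_Integration.integrable_diff) auto
  have "cc M 2 \<noteq> 0"
  proof
    assume "cc M 2 = 0"
    then have "AE x in M. (x - m)\<^sup>2 = 0"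
      unfolding cc2 by (subst (asm) integral_nonneg_eq_0_iff_AE[OF int]) auto
    then have "AE x in M. x \<in> {m}" by simp
    then have "measure M {m} = 1" by (subst prob_eq_1) auto
    with nc show False by blast
  qed
  moreover have "cc M 2 \<ge> 0" unfolding cc2 by simp
  ultimately show ?thesis by simp
qed


section \<open>The embedding\<close>

lemma anyon_fun_L2: "f \<in> anyon_fun q n \<Longrightarrow> f \<in> L2_fun (mXdist n)"
  by (simp add: anyon_fun_def)

lemma anyon_spaceE:
  assumes "C \<in> anyon_space q n"
  obtains f where "f \<in> anyon_fun q n" "C = cls (mXdist n) f"
  using assms unfolding anyon_space_eq by blast

lemma anyon_fun_zext: "f \<in> anyon_fun q n \<Longrightarrow> zext n f = f"
  by (auto simp: anyon_fun_def zext_def fun_eq_iff)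

lemma swap_sym_add:
  fixes f g :: "'d::{finite,linorder} conf \<Rightarrow> complex"
  assumes "swap_sym q n f" "swap_sym q n g"
  shows "swap_sym q n (\<lambda>x. f x + g x)"
  unfolding swap_sym_def
proof (intro ballI)
  fix x :: "'d conf" and j assume xj: "x \<in> Xdist n" "j \<in> {1..<n}"
  have "h x = Qfun q (x j) (x (Suc j)) * h (x \<circ> Transposition.transpose j (Suc j))"
    if "swap_sym q n h" for h
    using that xj unfolding swap_sym_def by blast
  from this[OF assms(1)] this[OF assms(2)]
  show "f x + g x = Qfun q (x j) (x (Suc j)) *
      (f (x \<circ> Transposition.transpose j (Suc j)) + g (x \<circ> Transposition.transpose j (Suc j)))"
    by (metis distrib_left)
qed

lemma swap_sym_scale:
  fixes f :: "'d::{finite,linorder} conf \<Rightarrow> complex"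
  assumes "swap_sym q n f"
  shows "swap_sym q n (\<lambda>x. a * f x)"
  unfolding swap_sym_def
proof (intro ballI)
  fix x :: "'d conf" and j assume "x \<in> Xdist n" "j \<in> {1..<n}"
  with assms have "f x = Qfun q (x j) (x (Suc j)) * f (x \<circ> Transposition.transpose j (Suc j))"
    unfolding swap_sym_def by blast
  then show "a * f x = Qfun q (x j) (x (Suc j)) * (a * f (x \<circ> Transposition.transpose j (Suc j)))"
    by simp
qed

lemma anyon_fun_add: "f \<in> anyon_fun q n \<Longrightarrow> g \<in> anyon_fun q n \<Longrightarrow> (\<lambda>x. f x + g x) \<in> anyon_fun q n"
  by (simp add: anyon_fun_def L2_fun_add(1) swap_sym_add)

lemma anyon_fun_scale: "f \<in> anyon_fun q n \<Longrightarrow> (\<lambda>x. a * f x) \<in> anyon_fun q n"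
  by (simp add: anyon_fun_def L2_fun_scale swap_sym_scale)

lemma anyon_fun_zero: "(\<lambda>x. 0) \<in> anyon_fun q n"
  by (simp add: anyon_fun_def swap_sym_def zero_L2_fun)

lemma embed_anyon:
  assumes "cc \<nu> 1 = 1" "f \<in> anyon_fun q n"
  shows "embed_n \<nu> n (cls (mXdist n) f) = cls (mnu \<nu> n) f" "f \<in> L2_fun (mnu \<nu> n)"
    "L2_normsq (mnu \<nu> n) (cls (mnu \<nu> n) f) = L2_normsq (mXdist n) (cls (mXdist n) f) * fact n"
    "Q_symmetric q n f"
proof -
  note L = anyon_fun_L2[OF assms(2)] and z = anyon_fun_zext[OF assms(2)]
  show "embed_n \<nu> n (cls (mXdist n) f) = cls (mnu \<nu> n) f"
    using embed_cls[OF assms(1) L] z by simp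
  show M: "f \<in> L2_fun (mnu \<nu> n)" using zext_L2_fun(1)[OF assms(1) L] z by simp
  show "L2_normsq (mnu \<nu> n) (cls (mnu \<nu> n) f) = L2_normsq (mXdist n) (cls (mXdist n) f) * fact n"
    using zext_L2_fun(2)[OF assms(1) L] z by (simp add: L2_normsq_cls L M)
  show "Q_symmetric q n f"
    using assms(2) by (intro swap_sym_imp_Q_symmetric) (auto simp: anyon_fun_def)
qed

lemma embed_anyon_space:
  assumes "cc \<nu> 1 = 1" "C \<in> anyon_space q n"
  shows "embed_n \<nu> n C \<in> ext_space q \<nu> n"
    "L2_normsq (mnu \<nu> n) (embed_n \<nu> n C) = L2_normsq (mXdist n) C * fact n"
proof -
  obtain f where f: "f \<in> anyon_fun q n" "C = cls (mXdist n) f" using assms(2) by (rule anyon_spaceE)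
  note e = embed_anyon[OF assms(1) f(1)]
  show "embed_n \<nu> n C \<in> ext_space q \<nu> n"
    unfolding f(2) e(1) ext_space_def L2_eq_cls using e(2,4) cls_self[OF e(2)] by blast
  show "L2_normsq (mnu \<nu> n) (embed_n \<nu> n C) = L2_normsq (mXdist n) C * fact n"
    unfolding f(2) e(1) by (rule e(3))
qed

lemma embed_anyon_inj:
  assumes "cc \<nu> 1 = 1" "C \<in> anyon_space q n" "C' \<in> anyon_space q n"
    and eq: "embed_n \<nu> n C = embed_n \<nu> n C'"
  shows "C = C'"
proof -
  obtain f where f: "f \<in> anyon_fun q n" "C = cls (mXdist n) f" using assms(2) by (rule anyon_spaceE)
  obtain g where g: "g \<in> anyon_fun q n" "C' = cls (mXdist n) g" using assms(3) by (rule anyon_spaceE)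
  have "AE x in mnu \<nu> n. f x = g x"
    using eq cls_eq_iff[OF embed_anyon(2)[OF assms(1) f(1)], of g]
    by (simp add: f(2) g(2) embed_anyon(1)[OF assms(1) f(1)] embed_anyon(1)[OF assms(1) g(1)])
  then have "AE x in mXdist n. f x = g x"
    using zext_AE_iff[OF assms(1), of n f g] by (simp add: anyon_fun_zext[OF f(1)] anyon_fun_zext[OF g(1)])
  then show ?thesis unfolding f(2) g(2) by (rule cls_cong)
qed

lemma anyon_space_add:
  assumes "cc \<nu> 1 = 1" "C \<in> anyon_space q n" "C' \<in> anyon_space q n"
  shows "L2_add (mXdist n) C C' \<in> anyon_space q n"
    "embed_n \<nu> n (L2_add (mXdist n) C C') = L2_add (mnu \<nu> n) (embed_n \<nu> n C) (embed_n \<nu> n C')"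
    "L2_normsq (mXdist n) (L2_add (mXdist n) C C')
       \<le> 2 * L2_normsq (mXdist n) C + 2 * L2_normsq (mXdist n) C'"
proof -
  obtain f where f: "f \<in> anyon_fun q n" "C = cls (mXdist n) f" using assms(2) by (rule anyon_spaceE)
  obtain g where g: "g \<in> anyon_fun q n" "C' = cls (mXdist n) g" using assms(3) by (rule anyon_spaceE)
  note fg = anyon_fun_add[OF f(1) g(1)]
  note L = anyon_fun_L2[OF f(1)] anyon_fun_L2[OF g(1)]
  have sum: "L2_add (mXdist n) C C' = cls (mXdist n) (\<lambda>x. f x + g x)"
    unfolding f(2) g(2) by (rule L2_add_cls[OF L])
  show "L2_add (mXdist n) C C' \<in> anyon_space q n"
    unfolding sum anyon_space_eq using fg by blast
  show "embed_n \<nu> n (L2_add (mXdist n) C C') = L2_add (mnu \<nu> n) (embed_n \<nu> n C) (embed_n \<nu> n C')"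
    unfolding sum embed_anyon(1)[OF assms(1) fg] unfolding f(2) g(2)
      embed_anyon(1)[OF assms(1) f(1)] embed_anyon(1)[OF assms(1) g(1)]
    by (rule L2_add_cls[symmetric]) (rule embed_anyon(2)[OF assms(1)], rule f g)+
  show "L2_normsq (mXdist n) (L2_add (mXdist n) C C')
       \<le> 2 * L2_normsq (mXdist n) C + 2 * L2_normsq (mXdist n) C'"
    unfolding sum unfolding f(2) g(2) L2_normsq_cls[OF L2_fun_add(1)[OF L]] L2_normsq_cls[OF L(1)]
      L2_normsq_cls[OF L(2)] by (rule L2_fun_add(2)[OF L])
qed

lemma anyon_space_scale:
  assumes "cc \<nu> 1 = 1" "C \<in> anyon_space q n"
  shows "L2_scale (mXdist n) a C \<in> anyon_space q n"
    "embed_n \<nu> n (L2_scale (mXdist n) a C) = L2_scale (mnu \<nu> n) a (embed_n \<nu> n C)"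
    "L2_normsq (mXdist n) (L2_scale (mXdist n) a C) = (cmod a)\<^sup>2 * L2_normsq (mXdist n) C"
proof -
  obtain f where f: "f \<in> anyon_fun q n" "C = cls (mXdist n) f" using assms(2) by (rule anyon_spaceE)
  note af = anyon_fun_scale[OF f(1), of a]
  note L = anyon_fun_L2[OF f(1)]
  have scale: "L2_scale (mXdist n) a C = cls (mXdist n) (\<lambda>x. a * f x)"
    unfolding f(2) by (rule L2_scale_cls[OF L])
  show "L2_scale (mXdist n) a C \<in> anyon_space q n"
    unfolding scale anyon_space_eq using af by blast
  show "embed_n \<nu> n (L2_scale (mXdist n) a C) = L2_scale (mnu \<nu> n) a (embed_n \<nu> n C)"
    unfolding scale embed_anyon(1)[OF assms(1) af] unfolding f(2) embed_anyon(1)[OF assms(1) f(1)]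
    by (rule L2_scale_cls[symmetric]) (rule embed_anyon(2)[OF assms(1) f(1)])
  show "L2_normsq (mXdist n) (L2_scale (mXdist n) a C) = (cmod a)\<^sup>2 * L2_normsq (mXdist n) C"
    unfolding scale unfolding f(2) L2_normsq_cls[OF L2_fun_scale[OF L]] L2_normsq_cls[OF L]
    by (simp add: norm_mult power_mult_distrib)
qed

lemma anyon_space_L2: "anyon_space q n \<subseteq> L2 (mXdist n)"
  by (auto simp: anyon_space_def)


section \<open>When the embedding is onto\<close>

text \<open>
  A stratum with a non-vanishing coefficient has no block of two or more elements, so it consists
  of configurations of distinct points.
\<close>

lemma AE_mnu_Xdist_concentrated:
  assumes c: "\<And>k. k \<ge> 2 \<Longrightarrow> cc \<nu> k = 0"
  shows "AE x in mnu \<nu> n. x \<in> (Xdist n :: 'd::{finite,linorder} conf set)"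
proof (rule AE_I)
  let ?A = "Xpow n - Xdist n :: 'd conf set"
  have A: "?A \<in> sets (mpow n)"
    using sets.compl_sets[OF Xdist_sets[of n, where ?'a='d]] by (simp add: space_mpow)
  show "?A \<in> sets (mnu \<nu> n)" using A by (simp add: sets_mnu)
  show "{x \<in> space (mnu \<nu> n). x \<notin> (Xdist n :: 'd conf set)} \<subseteq> ?A" by (auto simp: space_mnu)
  have "ennreal (part_coeff \<nu> n \<theta>) *
      emeasure (distr (mXdist (card \<theta>)) (mpow n) (diag_map n \<theta>)) (?A \<inter> Xpart n \<theta>) = 0"
    if \<theta>: "\<theta> \<in> Parts n" for \<theta>
  proof (cases "part_coeff \<nu> n \<theta> = 0")
    case False
    have p: "partition_on {1..n} \<theta>" using \<theta> by (simp add: Parts_def)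
    have fin: "finite \<theta>" by (rule finite_elements[OF _ p]) simp
    have card1: "i = j" if "B \<in> \<theta>" "i \<in> B" "j \<in> B" for B i j
    proof -
      have "cc \<nu> (card B) \<noteq> 0" using False fin that(1) by (auto simp: part_coeff_def)
      then have "card B \<le> 1" using c[of "card B"] by linarith
      moreover have "finite B" using partition_onD1[OF p] that(1) by (metis Sup_upper finite_atLeastAtMost finite_subset)
      ultimately show ?thesis using that(2,3) by (simp add: card_le_Suc0_iff_eq)
    qed
    have "Xpart n \<theta> \<subseteq> (Xdist n :: 'd conf set)"
    proof
      fix x :: "'d conf" assume x: "x \<in> Xpart n \<theta>"
      have "i = j" if ij: "i \<in> {1..n}" "j \<in> {1..n}" "x i = x j" for i j
      proof -
        obtain B where "B \<in> \<theta>" "i \<in> B" "j \<in> B" using x ij unfolding Xpart_def by blast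
        then show ?thesis by (rule card1)
      qed
      then show "x \<in> Xdist n" using x by (auto simp: Xdist_def Xpart_def inj_on_def)
    qed
    then have "?A \<inter> Xpart n \<theta> = {}" by blast
    then show ?thesis by simp
  qed simp
  then show "emeasure (mnu \<nu> n) ?A = 0" unfolding emeasure_mnu[OF A] by (intro sum.neutral ballI)
qed

text \<open>
  The diagonals are null sets here, so a \<open>Q\<close>-symmetric representative may be set to \<open>0\<close> on them.
\<close>

lemma ext_space_concentrated:
  fixes C :: "('d::{finite,linorder} conf \<Rightarrow> complex) set"
  assumes cc1: "cc \<nu> 1 = 1" and c: "\<And>k. k \<ge> 2 \<Longrightarrow> cc \<nu> k = 0"
    and C: "C \<in> ext_space q \<nu> n"
  shows "\<exists>C'\<in>anyon_space q n. embed_n \<nu> n C' = C"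
proof -
  obtain g where g: "C \<in> L2 (mnu \<nu> n)" "g \<in> C" "Q_symmetric q n g"
    using C by (auto simp: ext_space_def)
  note Cg = cls_eqI[OF g(1,2)]
  have L: "zext n g \<in> L2_fun (mXdist n)"
    by (intro L2_fun_mnu_restrict[OF cc1] zext_L2_fun(1)[OF cc1] Cg(2))
  have "swap_sym q n (zext n g)"
    unfolding swap_sym_def
  proof (intro ballI)
    fix x :: "'d conf" and j assume x: "x \<in> Xdist n" and j: "j \<in> {1..<n}"
    have "Transposition.transpose j (Suc j) permutes {1..n}" by (rule permutes_swap_id) (use j in auto)
    from Xdist_perm[OF this x] show "zext n g x =
        Qfun q (x j) (x (Suc j)) * zext n g (x \<circ> Transposition.transpose j (Suc j))"
      using Q_symmetric_imp_swap_sym[OF g(3)] x j by (simp add: zext_def swap_sym_def)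
  qed
  then have a: "zext n g \<in> anyon_fun q n" using L by (simp add: anyon_fun_def zext_def)
  have "AE x in mnu \<nu> n. x \<in> (Xdist n :: 'd conf set)"
    by (rule AE_mnu_Xdist_concentrated) (rule c)
  then have "AE x in mnu \<nu> n. zext n g x = g x"
    by eventually_elim (simp add: zext_def)
  then have "embed_n \<nu> n (cls (mXdist n) (zext n g)) = C"
    unfolding embed_anyon(1)[OF cc1 a] Cg(1) by (rule cls_cong)
  then show ?thesis unfolding anyon_space_eq using a by blast
qed

text \<open>
  The obstruction to surjectivity already appears for two particles, on the diagonal
  \<open>x 1 = x 2\<close>; the bounded piece \<open>diag_cube\<close> of it is taken to stay within square-integrable functions.
\<close>

definition pair_part :: "nat set set" where
  "pair_part = {{1..2}}"

lemma pair_part_in_Parts: "pair_part \<in> Parts 2"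
  by (auto simp: pair_part_def Parts_def partition_on_def disjoint_def)

lemma Xpart_pair: "x \<in> Xpart 2 pair_part \<longleftrightarrow> x \<in> Xpow 2 \<and> x 1 = x 2"
proof -
  have "{1..2::nat} = {1, 2}" by auto
  then show ?thesis unfolding Xpart_def pair_part_def by auto
qed

lemma diag_map_pair: "diag_map 2 pair_part y = (\<lambda>i\<in>{1..2}. y 1)"
proof -
  have bi: "block_index pair_part {1..2} = 1"
  proof -
    have "{A \<in> pair_part. Max A \<le> Max {1..2}} = {{1..2}}" by (auto simp: pair_part_def)
    then show ?thesis by (simp add: block_index_def)
  qed
  have b: "block pair_part 1 = {1..2}"
    unfolding block_def by (rule the_equality) (use bi in \<open>auto simp: pair_part_def\<close>)
  have "(THE j. j \<in> {1..card pair_part} \<and> i \<in> block pair_part j) = 1" if "i \<in> {1..2}" for i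
    by (rule the_equality) (use that b in \<open>auto simp: pair_part_def\<close>)
  then show ?thesis unfolding diag_map_def by (intro restrict_ext) simp
qed

definition diag_cube :: "'d::{finite,linorder} conf set" where
  "diag_cube = {x \<in> Xpart 2 pair_part. x 1 \<in> cbox 0 One}"

lemma diag_cube_sets: "(diag_cube :: 'd::{finite,linorder} conf set) \<in> sets (mpow 2)"
proof -
  have "(\<lambda>x. x 1) -` cbox 0 One \<inter> space (mpow 2) \<in> sets (mpow 2 :: 'd conf measure)"
    by (rule measurable_sets[OF measurable_coord]) auto
  from sets.Int[OF Xpart_sets[of 2 pair_part, where ?'d='d] this]
  show ?thesis
    by (rule back_subst[of "\<lambda>A. A \<in> sets (mpow 2)"]) (auto simp: diag_cube_def Xpart_def space_mpow)
qed

lemma emeasure_mnu_diag_cube: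
  "emeasure (mnu \<nu> 2) (diag_cube :: 'd::{finite,linorder} conf set) = ennreal (cc \<nu> 2)"
proof -
  interpret product_sigma_finite "\<lambda>_::nat. lborel :: (real^'d::{finite,linorder}) measure" ..
  let ?K = "cbox 0 One :: (real^'d::{finite,linorder}) set"
  have X1: "Xdist 1 = (Xpow 1 :: 'd conf set)" by (auto simp: Xdist_def inj_on_def)
  have mX1: "mXdist 1 = (mpow 1 :: 'd conf measure)"
    unfolding mXdist_def X1 space_mpow[symmetric]
  proof (rule measure_eqI)
    show "sets (restrict_space (mpow 1) (space (mpow 1))) = sets (mpow 1 :: 'd conf measure)"
      by (auto simp: sets_restrict_space_iff dest: sets.sets_into_space[THEN subsetD])
  qed (auto intro!: emeasure_restrict_space simp: sets_restrict_space_iff)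
  have m: "(\<lambda>y. \<lambda>i\<in>{1..2::nat}. y 1) \<in> measurable (mpow 1) (mpow 2 :: 'd conf measure)"
    unfolding mpow_def by (intro measurable_restrict measurable_component_singleton) auto
  have pre: "(\<lambda>y. \<lambda>i\<in>{1..2::nat}. y 1) -` diag_cube \<inter> space (mpow 1) = Pi\<^sub>E {1..1} (\<lambda>_. ?K)"
    by (auto simp: diag_cube_def Xpart_pair space_mpow Xpow_def PiE_iff)
  have "emeasure (distr (mXdist 1) (mpow 2) (diag_map 2 pair_part)) (diag_cube :: 'd conf set)
      = emeasure (mpow 1) (Pi\<^sub>E {1..1} (\<lambda>_. ?K))"
    unfolding diag_map_pair mX1 emeasure_distr[OF m diag_cube_sets] pre ..
  also have "\<dots> = emeasure lborel ?K"
    unfolding mpow_def by (subst emeasure_PiM) auto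
  also have "\<dots> = 1"
    by (subst emeasure_lborel_cbox) auto
  finally have one: "emeasure (distr (mXdist 1) (mpow 2) (diag_map 2 pair_part)) (diag_cube :: 'd conf set) = 1" .
  have card: "card pair_part = 1" by (simp add: pair_part_def)
  have "part_coeff \<nu> 2 pair_part = cc \<nu> 2"
    by (simp add: part_coeff_def pair_part_def)
  then show ?thesis
    using emeasure_mnu_Xpart[OF diag_cube_sets[where ?'d='d] _ pair_part_in_Parts, of \<nu>] one card
    by (auto simp: diag_cube_def)
qed

lemma diag_cube_perm:
  assumes \<sigma>: "\<sigma> permutes {1..2}" and x: "x \<in> diag_cube"
  shows "x \<circ> \<sigma> = x"
proof
  fix i :: nat
  have const: "x j = x 1" if "j \<in> {1..2}" for j
  proof -
    have "j = 1 \<or> j = 2" using that by auto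
    then show ?thesis using x by (auto simp: diag_cube_def Xpart_pair)
  qed
  show "(x \<circ> \<sigma>) i = x i"
  proof (cases "i \<in> {1..2}")
    case True
    then have "\<sigma> i \<in> {1..2}" using permutes_in_image[OF \<sigma>] by blast
    from const[OF this] const[OF True] show ?thesis by simp
  qed (simp add: permutes_not_in[OF \<sigma>])
qed

text \<open>
  Points of the diagonal are fixed by all permutations, and \<open>Qperm\<close> is an empty product there
  because the partition has only one block.
\<close>

lemma Q_symmetric_diag_cube:
  "Q_symmetric q 2 (indicator diag_cube :: 'd::{finite,linorder} conf \<Rightarrow> complex)"
  unfolding Q_symmetric_def
proof (intro allI impI ballI)
  fix \<pi> :: "nat \<Rightarrow> nat" and \<theta> and x :: "'d conf"
  assume \<pi>: "\<pi> permutes {1..2}" and \<theta>: "\<theta> \<in> Parts 2" and x: "x \<in> Xpart 2 \<theta>"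
  note \<pi>' = permutes_inv[OF \<pi>]
  show "(indicator diag_cube x :: complex) = Qperm q \<pi> \<theta> x * indicator diag_cube (x \<circ> inv \<pi>)"
  proof (cases "x \<in> diag_cube")
    case True
    then have "\<theta> = pair_part"
      by (intro Xpart_inject[OF \<theta> x pair_part_in_Parts]) (simp add: diag_cube_def)
    then have "{(i, j). 1 \<le> i \<and> i < j \<and> j \<le> card \<theta> \<and> hat_perm \<pi> \<theta> j < hat_perm \<pi> \<theta> i} = {}"
      by (auto simp: pair_part_def)
    then have "Qperm q \<pi> \<theta> x = 1" unfolding Qperm_def by (simp only: prod.empty)
    then show ?thesis using diag_cube_perm[OF \<pi>' True] by simp
  next
    case False
    have "x \<circ> inv \<pi> \<notin> diag_cube"
    proof
      assume c: "x \<circ> inv \<pi> \<in> diag_cube"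
      have "x = x \<circ> inv \<pi> \<circ> \<pi>" by (simp add: comp_assoc permutes_inv_o[OF \<pi>])
      also have "\<dots> = x \<circ> inv \<pi>" by (rule diag_cube_perm[OF \<pi> c])
      finally show False using c False by simp
    qed
    with False show ?thesis by simp
  qed
qed

lemma ext_space_not_onto:
  assumes cc1: "cc \<nu> 1 = 1" and c2: "cc \<nu> 2 > 0"
  shows "\<exists>C\<in>ext_space q \<nu> 2. \<forall>C'. embed_n \<nu> 2 C' \<noteq> (C :: ('d::{finite,linorder} conf \<Rightarrow> complex) set)"
proof -
  let ?f = "indicator diag_cube :: 'd conf \<Rightarrow> complex"
  have sq: "(cmod (?f x))\<^sup>2 = indicator diag_cube x" for x by (simp add: indicator_def)
  have L: "?f \<in> L2_fun (mnu \<nu> 2)"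
    unfolding L2_fun_def mem_Collect_eq sq
    using diag_cube_sets[where ?'d='d]
    by (auto simp: sets_mnu emeasure_mnu_diag_cube intro!: borel_measurable_indicator integrable_real_indicator)
  have ext: "cls (mnu \<nu> 2) ?f \<in> ext_space q \<nu> 2"
    unfolding ext_space_def L2_eq_cls using L cls_self[OF L] Q_symmetric_diag_cube by blast
  have "embed_n \<nu> 2 C' \<noteq> cls (mnu \<nu> 2) ?f" for C'
  proof
    assume "embed_n \<nu> 2 C' = cls (mnu \<nu> 2) ?f"
    then have "?f \<in> embed_n \<nu> 2 C'" using cls_self[OF L] by simp
    then obtain f' where f': "AE x in mnu \<nu> 2. ?f x = (if x \<in> Xdist 2 then f' x else 0)"
      by (auto simp: embed_n_def)
    have nd: "x \<notin> Xdist 2" if "x \<in> diag_cube" for x :: "'d conf"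
    proof
      assume "x \<in> Xdist 2"
      moreover have "x 1 = x 2" using that by (simp add: diag_cube_def Xpart_pair)
      ultimately show False using inj_onD[of x "{1..2}" 1 2] by (simp add: Xdist_def)
    qed
    have "AE x in mnu \<nu> 2. x \<notin> (diag_cube :: 'd conf set)"
      using f' by eventually_elim (use nd in \<open>auto split: if_splits\<close>)
    then have "emeasure (mnu \<nu> 2) (diag_cube :: 'd conf set) = 0"
      using diag_cube_sets[where ?'d='d] AE_iff_null_sets[of "diag_cube :: 'd conf set" "mnu \<nu> 2"]
      by (simp add: sets_mnu null_setsD1)
    with c2 show False by (simp add: emeasure_mnu_diag_cube)
  qed
  with ext show ?thesis by blast
qed


theorem mainTheorem7:
  fixes q :: complex and \<nu> :: "real measure"
  assumes q: "cmod q = 1"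
    and \<nu>: "real_distribution \<nu>" "finite_moments \<nu>" "polys_dense \<nu>"
  shows "let FQ = (anyon_fock q ::
               (nat \<Rightarrow> ('d::{finite,linorder} conf \<Rightarrow> complex) set) set);
             FQ\<nu> = ext_fock q \<nu>; J = fock_embed \<nu>
    in J ` FQ \<subseteq> FQ\<nu> \<and> FQ \<noteq> {} \<and>
       (\<forall>F\<in>FQ. \<forall>G\<in>FQ. seq_add mXdist F G \<in> FQ \<and>
           J (seq_add mXdist F G) = seq_add (mnu \<nu>) (J F) (J G)) \<and>
       (\<forall>a. \<forall>F\<in>FQ. seq_scale mXdist a F \<in> FQ \<and>
           J (seq_scale mXdist a F) = seq_scale (mnu \<nu>) a (J F)) \<and>
       inj_on J FQ \<and>
       (\<forall>F\<in>FQ. ext_normsq \<nu> (J F) = fock_normsq F) \<and>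
       (FQ\<nu> = J ` FQ \<longleftrightarrow> (\<exists>a. measure \<nu> {a} = 1))"
proof -
  interpret real_distribution \<nu> by (rule \<nu>(1))
  let ?FQ = "anyon_fock q :: (nat \<Rightarrow> ('d conf \<Rightarrow> complex) set) set"
  let ?J = "fock_embed \<nu> :: (nat \<Rightarrow> ('d conf \<Rightarrow> complex) set) \<Rightarrow> _"
  note cc1 = cc_1
  have FQ: "F n \<in> anyon_space q n" if "F \<in> ?FQ" for F n
    using that by (simp add: anyon_fock_def)
  have sm: "summable (\<lambda>n. L2_normsq (mXdist n) (F n) * fact n)" if "F \<in> ?FQ" for F
    using that by (simp add: anyon_fock_def)
  have normJ: "L2_normsq (mnu \<nu> n) (?J F n) = L2_normsq (mXdist n) (F n) * fact n"
    if "\<And>n. F n \<in> anyon_space q n" for F n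
    unfolding fock_embed_def by (rule embed_anyon_space(2)[OF cc1 that])
  have nn: "0 \<le> L2_normsq (mXdist n) C" if "C \<in> anyon_space q n"
    for n and C :: "('d conf \<Rightarrow> complex) set"
    using that anyon_space_L2 by (intro L2_normsq_nonneg) blast

  have into: "?J ` ?FQ \<subseteq> ext_fock q \<nu>"
  proof (rule image_subsetI)
    fix F assume F: "F \<in> ?FQ"
    have "?J F n \<in> ext_space q \<nu> n" for n
      unfolding fock_embed_def by (rule embed_anyon_space(1)[OF cc1 FQ[OF F]])
    then show "?J F \<in> ext_fock q \<nu>"
      using sm[OF F] normJ[of F] FQ[OF F] by (simp add: ext_fock_def)
  qed

  have zero: "cls (mXdist n) (\<lambda>x. 0) \<in> (anyon_space q n :: ('d conf \<Rightarrow> complex) set set)" for n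
    unfolding anyon_space_eq using anyon_fun_zero by blast
  have nonempty: "?FQ \<noteq> {}"
  proof -
    have "(\<lambda>n. cls (mXdist n) (\<lambda>x. 0)) \<in> ?FQ"
      using zero by (simp add: anyon_fock_def L2_normsq_cls[OF zero_L2_fun])
    then show ?thesis by blast
  qed

  have add: "seq_add mXdist F G \<in> ?FQ \<and> ?J (seq_add mXdist F G) = seq_add (mnu \<nu>) (?J F) (?J G)"
    if F: "F \<in> ?FQ" and G: "G \<in> ?FQ" for F G
  proof
    note A = anyon_space_add[OF cc1 FQ[OF F] FQ[OF G]]
    let ?N = "\<lambda>F n. L2_normsq (mXdist n) (F n :: ('d conf \<Rightarrow> complex) set) * fact n"
    have "summable (\<lambda>n. L2_normsq (mXdist n) (L2_add (mXdist n) (F n) (G n)) * fact n)"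
    proof (rule summable_comparison_test')
      show "summable (\<lambda>n. 2 * ?N F n + 2 * ?N G n)"
        by (intro summable_add summable_mult sm F G)
      fix n :: nat
      have "L2_normsq (mXdist n) (L2_add (mXdist n) (F n) (G n)) * fact n
          \<le> (2 * L2_normsq (mXdist n) (F n) + 2 * L2_normsq (mXdist n) (G n)) * fact n"
        by (rule mult_right_mono[OF A(3)]) simp
      then show "norm (L2_normsq (mXdist n) (L2_add (mXdist n) (F n) (G n)) * fact n)
          \<le> 2 * ?N F n + 2 * ?N G n"
        using nn[OF A(1)] by (simp add: algebra_simps)
    qed
    then show "seq_add mXdist F G \<in> ?FQ" using A(1) by (simp add: anyon_fock_def seq_add_def)
    show "?J (seq_add mXdist F G) = seq_add (mnu \<nu>) (?J F) (?J G)"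
      using A(2) by (simp add: fock_embed_def seq_add_def)
  qed

  have scale: "seq_scale mXdist a F \<in> ?FQ \<and> ?J (seq_scale mXdist a F) = seq_scale (mnu \<nu>) a (?J F)"
    if F: "F \<in> ?FQ" for F a
  proof
    note A = anyon_space_scale[OF cc1 FQ[OF F]]
    have "summable (\<lambda>n. (cmod a)\<^sup>2 * (L2_normsq (mXdist n) (F n) * fact n))"
      by (intro summable_mult sm F)
    then show "seq_scale mXdist a F \<in> ?FQ"
      using A(1,3) by (simp add: anyon_fock_def seq_scale_def mult.assoc)
    show "?J (seq_scale mXdist a F) = seq_scale (mnu \<nu>) a (?J F)"
      using A(2) by (simp add: fock_embed_def seq_scale_def)
  qed

  have inj: "inj_on ?J ?FQ"
  proof (rule inj_onI, rule ext)
    fix F G n assume FG: "F \<in> ?FQ" "G \<in> ?FQ" and eq: "?J F = ?J G"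
    show "F n = G n"
      using fun_cong[OF eq, of n] unfolding fock_embed_def
      by (rule embed_anyon_inj[OF cc1 FQ[OF FG(1)] FQ[OF FG(2)]])
  qed

  have norm: "ext_normsq \<nu> (?J F) = fock_normsq F" if "F \<in> ?FQ" for F
    using normJ[of F] FQ[OF that] by (simp add: ext_normsq_def fock_normsq_def)

  have onto: "ext_fock q \<nu> \<subseteq> ?J ` ?FQ" if a: "measure \<nu> {a} = 1" for a
  proof
    fix G :: "nat \<Rightarrow> ('d conf \<Rightarrow> complex) set" assume G: "G \<in> ext_fock q \<nu>"
    have "\<exists>C\<in>anyon_space q n. embed_n \<nu> n C = G n" for n
      using G by (intro ext_space_concentrated[OF cc1 cc_concentrated[OF a]]) (auto simp: ext_fock_def)
    then obtain F where F: "\<And>n. F n \<in> anyon_space q n" "\<And>n. embed_n \<nu> n (F n) = G n" by metis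
    have JF: "?J F = G" using F(2) by (simp add: fock_embed_def)
    moreover have "F \<in> ?FQ"
      using F(1) G normJ[OF F(1)] by (simp add: anyon_fock_def ext_fock_def JF)
    ultimately show "G \<in> ?J ` ?FQ" by blast
  qed

  have not_onto: "ext_fock q \<nu> \<noteq> ?J ` ?FQ" if nc: "\<nexists>a. measure \<nu> {a} = 1"
  proof
    assume eq: "ext_fock q \<nu> = ?J ` ?FQ"
    obtain C :: "('d conf \<Rightarrow> complex) set" where C: "C \<in> ext_space q \<nu> 2" "\<And>C'. embed_n \<nu> 2 C' \<noteq> C"
      using ext_space_not_onto[OF cc1 cc_2_pos[OF \<nu>(2) nc]] by blast
    \<comment> \<open>Altering one component of a square-summable sequence keeps it square-summable.\<close>
    obtain Z where Z: "Z \<in> ?FQ" using nonempty by blast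
    have "?J Z \<in> ext_fock q \<nu>" using into Z by blast
    then have Z: "?J Z n \<in> ext_space q \<nu> n" "summable (\<lambda>n. L2_normsq (mnu \<nu> n) (?J Z n))" for n
      by (simp_all add: ext_fock_def)
    have "\<forall>\<^sub>F n in sequentially. L2_normsq (mnu \<nu> n) (((?J Z)(2 := C)) n) = L2_normsq (mnu \<nu> n) (?J Z n)"
      using eventually_gt_at_top[of 2] by eventually_elim simp
    from summable_cong[OF this] have "(?J Z)(2 := C) \<in> ext_fock q \<nu>"
      using Z C(1) by (simp add: ext_fock_def)
    then obtain F where "(?J Z)(2 := C) = ?J F" using eq by blast
    then have "embed_n \<nu> 2 (F 2) = C" by (metis fock_embed_def fun_upd_same)
    with C(2) show False by blast
  qed

  show ?thesis
    unfolding Let_def using into nonempty add scale inj norm onto not_onto by blast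
qed

end
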